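(* Let $\pi\colon W\to M$ be a locally isometric covering of connected Riemannian manifolds, and let $\rho_W$, $\rho_M$ be the distance functions generated by the Riemannian metrics of $W$ and $M$. Then the Steiner ratio of the base $M$ is greater than or equal to the Steiner ratio of the total space $W$, that is, $m(M,\rho_M)\ge m(W,\rho_W)$.
   Context: For a metric space $(X,\rho)$ and a finite nonempty subset $N\subset X$, $\rho(\mathrm{MST}_N)$ denotes the least weight of a spanning tree of the complete graph on $N$, where the edge $xy$ has weight $\rho(x,y)$ and the weight of a graph is the sum of the weights of its edges. Further, $\rho(\mathrm{SMT}_N)=\inf\rho(\mathrm{MST}_{\bar N})$, the infimum being over all finite subsets $\bar N\subset X$ with $\bar N\supset N$ (whether or not it is attained). The Steiner ratio of $(X,\rho)$ (a space with at least two points) is $m(X,\rho)=\inf_N \rho(\mathrm{SMT}_N)/\rho(\mathrm{MST}_N)$, the infimum being over all finite subsets $N\subset X$ with at least two points. For a connected Riemannian manifold (of positive dimension), the distance generated by the Riemannian metric is $\rho(x,y)=\inf_\gamma \operatorname{len}(\gamma)$ over piecewise-smooth curves $\gamma$ joining $x$ and $y$. A locally isometric covering is a covering map that is a local isometry of Riemannian manifolds. *)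

theory Defs
  imports "HOL-Analysis.Analysis"
begin

section \<open>Steiner ratio of a metric space\<close>

text \<open>A simple graph on \<open>N\<close> is given by its set of edges, an edge being an unordered pair
  \<open>{x, y}\<close> with \<open>x \<noteq> y\<close>. (The notion of tree in the AFP entry Graph Theory only excludes
  directed cycles, hence is not the one for undirected graphs.)\<close>

definition complete_edges :: "'a set \<Rightarrow> 'a set set" where
  "complete_edges N = {{x, y} | x y. x \<in> N \<and> y \<in> N \<and> x \<noteq> y}"

definition graph_connected :: "'a set \<Rightarrow> 'a set set \<Rightarrow> bool" where
  "graph_connected N E \<longleftrightarrow> (\<forall>x\<in>N. \<forall>y\<in>N. (x, y) \<in> {(u, v). {u, v} \<in> E}\<^sup>*)"

definition graph_cycle :: "'a set set \<Rightarrow> 'a list \<Rightarrow> bool" where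
  "graph_cycle E p \<longleftrightarrow> 3 \<le> length p \<and> distinct p \<and>
     (\<forall>i<length p. {p ! i, p ! (Suc i mod length p)} \<in> E)"

definition is_spanning_tree :: "'a set \<Rightarrow> 'a set set \<Rightarrow> bool" where
  "is_spanning_tree N E \<longleftrightarrow>
     E \<subseteq> complete_edges N \<and> graph_connected N E \<and> \<not> (\<exists>p. graph_cycle E p)"

text \<open>The description below determines a number because distance functions are symmetric.\<close>

definition edge_weight :: "('a \<Rightarrow> 'a \<Rightarrow> real) \<Rightarrow> 'a set \<Rightarrow> real" where
  "edge_weight \<rho> e = (THE r. \<exists>x y. e = {x, y} \<and> r = \<rho> x y)"

definition mst_weight :: "('a \<Rightarrow> 'a \<Rightarrow> real) \<Rightarrow> 'a set \<Rightarrow> real" where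
  "mst_weight \<rho> N = Min {\<Sum>e\<in>E. edge_weight \<rho> e | E. is_spanning_tree N E}"

definition smt_weight :: "'a set \<Rightarrow> ('a \<Rightarrow> 'a \<Rightarrow> real) \<Rightarrow> 'a set \<Rightarrow> real" where
  "smt_weight X \<rho> N = Inf {mst_weight \<rho> N' | N'. finite N' \<and> N \<subseteq> N' \<and> N' \<subseteq> X}"

definition steiner_ratio :: "'a set \<Rightarrow> ('a \<Rightarrow> 'a \<Rightarrow> real) \<Rightarrow> real" where
  "steiner_ratio X \<rho> =
     Inf {smt_weight X \<rho> N / mst_weight \<rho> N | N. finite N \<and> N \<subseteq> X \<and> 2 \<le> card N}"


section \<open>Smooth functions on open subsets of Euclidean spaces\<close>

text \<open>Continuity of all iterated directional derivatives up to order \<open>k\<close>; since the domain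
  is finite-dimensional, this is the usual \<open>C\<close>-\<open>k\<close> condition.\<close>

primrec Ck_on :: "nat \<Rightarrow> 'e::euclidean_space set \<Rightarrow> ('e \<Rightarrow> 'f::real_normed_vector) \<Rightarrow> bool" where
  "Ck_on 0 S f \<longleftrightarrow> continuous_on S f"
| "Ck_on (Suc k) S f \<longleftrightarrow>
     (\<forall>x\<in>S. f differentiable (at x)) \<and> (\<forall>v. Ck_on k S (\<lambda>x. frechet_derivative f (at x) v))"

definition smooth_on :: "'e::euclidean_space set \<Rightarrow> ('e \<Rightarrow> 'f::real_normed_vector) \<Rightarrow> bool" where
  "smooth_on S f \<longleftrightarrow> (\<forall>k. Ck_on k S f)"


section \<open>Riemannian manifolds\<close>

text \<open>A chart \<open>(U, \<phi>)\<close> consists of an open subset \<open>U\<close> of the manifold and a homeomorphism \<open>\<phi>\<close>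
  of \<open>U\<close> onto an open subset of the Euclidean model space \<open>'e\<close> (so the dimension is
  \<open>DIM('e)\<close>, which is positive). The atlas need not be maximal. The Riemannian metric is
  the classical covariant 2-tensor: \<open>metric M c p\<close> is the inner product on the tangent space at
  \<open>p\<close>, expressed in the coordinates of the chart \<open>c\<close> around \<open>p\<close>.\<close>

type_synonym ('a, 'e) chart = "'a set \<times> ('a \<Rightarrow> 'e)"

record ('a, 'e) riem =
  points :: "'a set"
  atlas :: "('a, 'e) chart set"
  metric :: "('a, 'e) chart \<Rightarrow> 'a \<Rightarrow> 'e \<Rightarrow> 'e \<Rightarrow> real"

text \<open>The expression of a map in charts of the source and of the target.\<close>

definition chart_rep :: "('a, 'e) chart \<Rightarrow> ('b, 'f) chart \<Rightarrow> ('a \<Rightarrow> 'b) \<Rightarrow> 'e \<Rightarrow> 'f" where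
  "chart_rep c d f = snd d \<circ> f \<circ> inv_into (fst c) (snd c)"

definition manifold_chart :: "'a::topological_space set \<Rightarrow> ('a, 'e::euclidean_space) chart \<Rightarrow> bool" where
  "manifold_chart S c \<longleftrightarrow>
     openin (top_of_set S) (fst c) \<and> open (snd c ` fst c) \<and>
     (\<exists>\<psi>. homeomorphism (fst c) (snd c ` fst c) (snd c) \<psi>)"

definition smooth_atlas :: "'a::topological_space set \<Rightarrow> ('a, 'e::euclidean_space) chart set \<Rightarrow> bool" where
  "smooth_atlas S A \<longleftrightarrow>
     (\<forall>c\<in>A. manifold_chart S c) \<and> (\<Union>c\<in>A. fst c) = S \<and>
     (\<forall>c\<in>A. \<forall>d\<in>A. smooth_on (snd c ` (fst c \<inter> fst d)) (chart_rep c d id))"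

definition riemannian_metric :: "('a::topological_space, 'e::euclidean_space) riem \<Rightarrow> bool" where
  "riemannian_metric M \<longleftrightarrow>
     (\<forall>c\<in>atlas M. \<forall>p\<in>fst c.
        bilinear (metric M c p) \<and>
        (\<forall>u v. metric M c p u v = metric M c p v u) \<and>
        (\<forall>v. v \<noteq> 0 \<longrightarrow> metric M c p v v > 0)) \<and>
     (\<forall>c\<in>atlas M. \<forall>u v.
        smooth_on (snd c ` fst c) (\<lambda>x. metric M c (inv_into (fst c) (snd c) x) u v)) \<and>
     (\<forall>c\<in>atlas M. \<forall>d\<in>atlas M. \<forall>p\<in>fst c \<inter> fst d.
        let D = frechet_derivative (chart_rep c d id) (at (snd c p))
        in \<forall>u v. metric M c p u v = metric M d p (D u) (D v))"

definition connected_riemannian_manifold ::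
    "('a::topological_space, 'e::euclidean_space) riem \<Rightarrow> bool" where
  "connected_riemannian_manifold M \<longleftrightarrow>
     points M \<noteq> {} \<and> connected (points M) \<and>
     Hausdorff_space (top_of_set (points M)) \<and> second_countable (top_of_set (points M)) \<and>
     smooth_atlas (points M) (atlas M) \<and> riemannian_metric M"


section \<open>The distance generated by a Riemannian metric\<close>

text \<open>Smooth curves defined on an open set \<open>J\<close> of parameters.\<close>

definition smooth_curve ::
    "('a::topological_space, 'e::euclidean_space) riem \<Rightarrow> real set \<Rightarrow> (real \<Rightarrow> 'a) \<Rightarrow> bool" where
  "smooth_curve M J \<gamma> \<longleftrightarrow>
     continuous_on J \<gamma> \<and> \<gamma> ` J \<subseteq> points M \<and>
     (\<forall>c\<in>atlas M. smooth_on (J \<inter> \<gamma> -` fst c) (snd c \<circ> \<gamma>))"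

text \<open>Smoothness on a closed interval means existence of a smooth extension to an open interval.\<close>

definition smooth_curve_segment ::
    "('a::topological_space, 'e::euclidean_space) riem \<Rightarrow> (real \<Rightarrow> 'a) \<Rightarrow> real \<Rightarrow> real \<Rightarrow> bool" where
  "smooth_curve_segment M \<gamma> s t \<longleftrightarrow>
     (\<exists>\<delta>>0. \<exists>\<eta>. smooth_curve M {s - \<delta> <..< t + \<delta>} \<eta> \<and> (\<forall>u\<in>{s..t}. \<eta> u = \<gamma> u))"

definition piecewise_smooth_curve ::
    "('a::topological_space, 'e::euclidean_space) riem \<Rightarrow> (real \<Rightarrow> 'a) \<Rightarrow> real \<Rightarrow> real \<Rightarrow> bool" where
  "piecewise_smooth_curve M \<gamma> a b \<longleftrightarrow>
     a < b \<and> continuous_on {a..b} \<gamma> \<and> \<gamma> ` {a..b} \<subseteq> points M \<and>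
     (\<exists>n. \<exists>\<tau>::nat \<Rightarrow> real. \<tau> 0 = a \<and> \<tau> n = b \<and>
        (\<forall>i<n. \<tau> i < \<tau> (Suc i) \<and> smooth_curve_segment M \<gamma> (\<tau> i) (\<tau> (Suc i))))"

text \<open>Norm of the velocity vector, computed in some chart; by the transformation law of the metric
  the choice of the chart does not matter. The value is meaningful where \<open>\<gamma>\<close> is differentiable,
  which for a piecewise smooth curve on \<open>[a, b]\<close> may fail only at \<open>a\<close>, \<open>b\<close> and the finitely many
  breakpoints, and these do not affect the integral defining the length.\<close>

definition curve_speed ::
    "('a::topological_space, 'e::euclidean_space) riem \<Rightarrow> (real \<Rightarrow> 'a) \<Rightarrow> real \<Rightarrow> real" where
  "curve_speed M \<gamma> t =
     (let c = (SOME c. c \<in> atlas M \<and> \<gamma> t \<in> fst c);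
          v = vector_derivative (snd c \<circ> \<gamma>) (at t)
      in sqrt (metric M c (\<gamma> t) v v))"

definition curve_length ::
    "('a::topological_space, 'e::euclidean_space) riem \<Rightarrow> (real \<Rightarrow> 'a) \<Rightarrow> real \<Rightarrow> real \<Rightarrow> real" where
  "curve_length M \<gamma> a b = integral {a..b} (curve_speed M \<gamma>)"

definition riem_dist ::
    "('a::topological_space, 'e::euclidean_space) riem \<Rightarrow> 'a \<Rightarrow> 'a \<Rightarrow> real" where
  "riem_dist M x y =
     Inf {curve_length M \<gamma> a b | \<gamma> a b. piecewise_smooth_curve M \<gamma> a b \<and> \<gamma> a = x \<and> \<gamma> b = y}"


section \<open>Locally isometric coverings\<close>

definition smooth_map_on ::
    "('a::topological_space, 'e::euclidean_space) riem \<Rightarrow>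
     ('b::topological_space, 'f::euclidean_space) riem \<Rightarrow> 'a set \<Rightarrow> ('a \<Rightarrow> 'b) \<Rightarrow> bool" where
  "smooth_map_on W M A f \<longleftrightarrow>
     continuous_on A f \<and> f ` A \<subseteq> points M \<and>
     (\<forall>c\<in>atlas W. \<forall>d\<in>atlas M.
        smooth_on (snd c ` (A \<inter> fst c \<inter> f -` fst d)) (chart_rep c d f))"

text \<open>\<open>f\<close> restricts to a diffeomorphism of the open set \<open>A\<close> onto the open set \<open>B\<close> whose
  differentials preserve the inner products.\<close>

definition isometry_between ::
    "('a::topological_space, 'e::euclidean_space) riem \<Rightarrow>
     ('b::topological_space, 'f::euclidean_space) riem \<Rightarrow> 'a set \<Rightarrow> 'b set \<Rightarrow> ('a \<Rightarrow> 'b) \<Rightarrow> bool" where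
  "isometry_between W M A B f \<longleftrightarrow>
     openin (top_of_set (points W)) A \<and> openin (top_of_set (points M)) B \<and>
     (\<exists>g. homeomorphism A B f g \<and> smooth_map_on W M A f \<and> smooth_map_on M W B g) \<and>
     (\<forall>c\<in>atlas W. \<forall>d\<in>atlas M. \<forall>p\<in>A \<inter> fst c \<inter> f -` fst d.
        let D = frechet_derivative (chart_rep c d f) (at (snd c p))
        in \<forall>u v. metric W c p u v = metric M d (f p) (D u) (D v))"

definition local_isometry ::
    "('a::topological_space, 'e::euclidean_space) riem \<Rightarrow>
     ('b::topological_space, 'f::euclidean_space) riem \<Rightarrow> ('a \<Rightarrow> 'b) \<Rightarrow> bool" where
  "local_isometry W M f \<longleftrightarrow> (\<forall>p\<in>points W. \<exists>A B. p \<in> A \<and> isometry_between W M A B f)"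

definition locally_isometric_covering ::
    "('a::topological_space, 'e::euclidean_space) riem \<Rightarrow>
     ('b::topological_space, 'f::euclidean_space) riem \<Rightarrow> ('a \<Rightarrow> 'b) \<Rightarrow> bool" where
  "locally_isometric_covering W M \<pi> \<longleftrightarrow>
     covering_space (points W) \<pi> (points M) \<and> local_isometry W M \<pi>"

end

theory Submission
  imports Defs
begin

text \<open>A minimum spanning tree of a finite set in \<open>M\<close> can be lifted to \<open>W\<close> edge by edge: an almost
  minimizing curve between the ends of an edge lifts, from any point over its start, to a curve of
  the same length. So the lifted vertices have a spanning tree of almost the same weight, and a set
  \<open>N\<close> has a lift whose Steiner trees weigh almost at most as much as those of \<open>N\<close>. As the projection
  does not increase distances, the minimum spanning tree of this lift is at least as heavy as that
  of \<open>N\<close>. Comparing ratios uses that the distance on \<open>M\<close> is positive off the diagonal.\<close>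

section \<open>Spanning trees\<close>

text \<open>Lifting along a tree meets no obstruction because a tree has no cycles: around a cycle
  the lifted curve may end at another point of the fibre. What is lifted is the competitor
  \<open>N'\<close>, and the section is then restricted to \<open>N\<close>, so that terminals and
  Steiner points fit together. An infimum over curves need not be attained, so the lift carries an
  error \<epsilon>, which is removed at the end. Positivity of the distance on \<open>M\<close>
  matters because a quotient with denominator zero is zero in HOL: a set of vanishing tree weight
  would have ratio zero whatever its lifts. The combinatorial half is stated for an arbitrary map
  \<open>p\<close> and symmetric distances; the geometric half has to supply that \<open>p\<close>
  does not increase distances, that almost minimizing curves lift, and that distinct points of the
  base have positive distance.\<close>

lemma graph_cycle_vertex_in_edge:
  assumes "graph_cycle E p" "x \<in> set p"
  shows "x \<in> \<Union>E"
  using assms unfolding graph_cycle_def in_set_conv_nth by blast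

text \<open>Both edges of the cycle at \<open>v\<close> would have to be \<open>{u, v}\<close>, so
  \<open>u\<close> would be both neighbours of \<open>v\<close>, which are distinct in a cycle of
  length at least 3.\<close>

lemma graph_cycle_remove_leaf:
  assumes cyc: "graph_cycle (insert {u, v} E) p" and v: "v \<notin> \<Union>E" and "u \<noteq> v"
  shows "graph_cycle E p"
proof -
  let ?n = "length p"
  have n: "3 \<le> ?n" and dist: "distinct p"
    and edge: "\<And>i. i < ?n \<Longrightarrow> {p ! i, p ! (Suc i mod ?n)} \<in> insert {u, v} E"
    using cyc by (auto simp: graph_cycle_def)
  have "v \<notin> set p"
  proof
    assume "v \<in> set p"
    then obtain i where i: "i < ?n" "p ! i = v" by (auto simp: in_set_conv_nth)
    \<comment> \<open>Cyclic successor and predecessor of the position \<open>i\<close> of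
      \<open>v\<close>.\<close>
    define j where "j = Suc i mod ?n"
    define k where "k = (if i = 0 then ?n - 1 else i - 1)"
    have jk: "j < ?n" "k < ?n" "Suc k mod ?n = i" "j \<noteq> k"
      using n i by (auto simp: j_def k_def mod_Suc)
    have "{v, p ! j} = {u, v}" "{p ! k, v} = {u, v}"
      using edge[OF i(1)] edge[OF jk(2)] v i(2) jk(3) by (auto simp: j_def)
    then have "p ! j = p ! k" using \<open>u \<noteq> v\<close> by (auto simp: doubleton_eq_iff)
    then show False using dist jk by (simp add: nth_eq_iff_index_eq)
  qed
  moreover have "p ! i \<in> set p" if "i < ?n" for i using that by simp
  ultimately have "{p ! i, p ! (Suc i mod ?n)} \<noteq> {u, v}" if "i < ?n" for i
  proof -
    have "Suc i mod ?n < ?n" using n by (intro mod_less_divisor) linarith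
    then show ?thesis using \<open>v \<notin> set p\<close> that by (metis insertI1 insert_commute nth_mem insertE singletonD)
  qed
  then show ?thesis using n dist edge by (auto simp: graph_cycle_def)
qed

lemma graph_cycle_image:
  assumes "graph_cycle E p" "inj_on f (set p)"
  shows "graph_cycle ((`) f ` E) (map f p)"
  unfolding graph_cycle_def
proof (intro conjI allI impI)
  show "3 \<le> length (map f p)" "distinct (map f p)"
    using assms by (auto simp: graph_cycle_def distinct_map)
  fix i assume "i < length (map f p)"
  then have i: "i < length p" by simp
  moreover have "Suc i mod length p < length p"
    using i by (intro mod_less_divisor) linarith
  moreover have "f ` {p ! i, p ! (Suc i mod length p)} \<in> (`) f ` E"
    using assms(1) i by (intro imageI) (simp add: graph_cycle_def)
  ultimately show "{map f p ! i, map f p ! (Suc i mod length (map f p))} \<in> (`) f ` E"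
    by simp
qed

lemma complete_edges_image:
  assumes "inj_on s N"
  shows "(`) s ` complete_edges N \<subseteq> complete_edges (s ` N)"
proof clarify
  fix e assume "e \<in> complete_edges N"
  then obtain x y where "e = {x, y}" "x \<in> N" "y \<in> N" "x \<noteq> y"
    by (auto simp: complete_edges_def)
  moreover from this have "s x \<noteq> s y" using assms by (auto dest: inj_onD)
  ultimately show "s ` e \<in> complete_edges (s ` N)" unfolding complete_edges_def by auto
qed

lemma complete_edges_subset_Pow: "complete_edges N \<subseteq> Pow N"
  by (auto simp: complete_edges_def)

lemma graph_connected_image:
  assumes "graph_connected N E"
  shows "graph_connected (s ` N) ((`) s ` E)"
proof -
  have "(s u, s v) \<in> {(u, v). {u, v} \<in> (`) s ` E}\<^sup>*" if "(u, v) \<in> {(u, v). {u, v} \<in> E}\<^sup>*" for u v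
    using that
  proof (induction rule: rtrancl_induct)
    case (step y z)
    have "{s y, s z} = s ` {y, z}" by simp
    then have "(s y, s z) \<in> {(u, v). {u, v} \<in> (`) s ` E}" using step by blast
    with step.IH show ?case by (rule rtrancl_into_rtrancl)
  qed simp
  then show ?thesis using assms by (auto simp: graph_connected_def)
qed

text \<open>Every vertex of a cycle in the image graph lies on an edge, hence in the image of
  \<open>N\<close>, so the inverse of \<open>s\<close> on \<open>N\<close> carries the cycle back to
  one in \<open>E\<close>.\<close>

lemma is_spanning_tree_image:
  assumes E: "is_spanning_tree N E" and inj: "inj_on s N"
  shows "is_spanning_tree (s ` N) ((`) s ` E)"
proof -
  have EN: "E \<subseteq> Pow N" and EC: "E \<subseteq> complete_edges N"
    using E complete_edges_subset_Pow unfolding is_spanning_tree_def by blast+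
  have "\<not> graph_cycle ((`) s ` E) p" for p
  proof
    assume p: "graph_cycle ((`) s ` E) p"
    have "set p \<subseteq> s ` N" using graph_cycle_vertex_in_edge[OF p] EN by blast
    then have "graph_cycle ((`) (inv_into N s) ` (`) s ` E) (map (inv_into N s) p)"
      using p by (intro graph_cycle_image inj_on_inv_into)
    moreover have "inv_into N s ` s ` e = e" if "e \<in> E" for e
      using that EN inj by (metis PowD inv_into_image_cancel subsetD)
    then have "(`) (inv_into N s) ` (`) s ` E = E" by (simp add: image_image)
    ultimately show False using E by (auto simp: is_spanning_tree_def)
  qed
  then show ?thesis
    using E complete_edges_image[OF inj] EC unfolding is_spanning_tree_def
    by (meson graph_connected_image image_mono order_trans)
qed

lemma sum_edges_image:
  assumes "inj_on s N" "E \<subseteq> Pow N"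
  shows "(\<Sum>e\<in>(`) s ` E. w e) = (\<Sum>e\<in>E. w (s ` e))"
  using assms by (subst sum.reindex) (auto simp: inj_on_subset[OF inj_on_image_Pow])

lemma is_spanning_tree_insert_leaf:
  assumes E: "is_spanning_tree V E" and u: "u \<in> V" and v: "v \<notin> V"
  shows "is_spanning_tree (insert v V) (insert {u, v} E)"
proof -
  let ?R = "{(x, y). {x, y} \<in> insert {u, v} E}"
  have EC: "E \<subseteq> complete_edges V" and con: "graph_connected V E"
    using E by (auto simp: is_spanning_tree_def)
  have "{u, v} \<in> complete_edges (insert v V)" using u v by (auto simp: complete_edges_def)
  moreover have "complete_edges V \<subseteq> complete_edges (insert v V)" by (auto simp: complete_edges_def)
  ultimately have "insert {u, v} E \<subseteq> complete_edges (insert v V)" using EC by blast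
  moreover have "graph_connected (insert v V) (insert {u, v} E)"
  proof -
    have "{(x, y). {x, y} \<in> E} \<subseteq> ?R" by blast
    then have old: "(x, y) \<in> ?R\<^sup>*" if "x \<in> V" "y \<in> V" for x y
      using con that rtrancl_mono unfolding graph_connected_def by blast
    have uv: "(u, v) \<in> ?R" "(v, u) \<in> ?R" by (auto simp: insert_commute)
    have "(x, v) \<in> ?R\<^sup>*" "(v, x) \<in> ?R\<^sup>*" if "x \<in> V" for x
      using old[OF that u] old[OF u that] uv
      by (meson rtrancl_into_rtrancl converse_rtrancl_into_rtrancl)+
    then show ?thesis using old by (auto simp: graph_connected_def)
  qed
  moreover have "\<not> graph_cycle (insert {u, v} E) p" for p
  proof
    assume "graph_cycle (insert {u, v} E) p"
    moreover have "v \<notin> \<Union>E" using EC complete_edges_subset_Pow[of V] v by blast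
    moreover have "u \<noteq> v" using u v by blast
    ultimately have "graph_cycle E p" by (rule graph_cycle_remove_leaf)
    then show False using E by (auto simp: is_spanning_tree_def)
  qed
  ultimately show ?thesis by (auto simp: is_spanning_tree_def)
qed

text \<open>A walk in \<open>E\<close> from \<open>r\<close> to a point of \<open>N\<close> outside
  \<open>V\<close> has to step out of \<open>V\<close> somewhere.\<close>

lemma graph_connected_edge_leaving:
  assumes "graph_connected N E" "r \<in> V" "V \<subset> N"
  obtains u v where "u \<in> V" "v \<notin> V" "{u, v} \<in> E"
proof -
  obtain y where y: "y \<in> N" "y \<notin> V" using assms by blast
  have "(r, y) \<in> {(u, v). {u, v} \<in> E}\<^sup>*" using assms y by (auto simp: graph_connected_def)
  then have "\<exists>u v. u \<in> V \<and> v \<notin> V \<and> {u, v} \<in> E" using \<open>r \<in> V\<close> y(2)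
    by (induction rule: rtrancl_induct) auto
  then show thesis using that by blast
qed

text \<open>The tree is grown from a single vertex by adding leaves, and the section is chosen along with it:
  only the one edge ending at the new leaf constrains its value there.\<close>

lemma spanning_tree_with_section:
  assumes fin: "finite N" and con: "graph_connected N E" and EC: "E \<subseteq> complete_edges N"
    and "N \<noteq> {}" and ne: "\<And>x. x \<in> N \<Longrightarrow> F x \<noteq> {}"
    and lift: "\<And>x y a. {x, y} \<in> E \<Longrightarrow> a \<in> F x \<Longrightarrow> \<exists>b\<in>F y. P {x, y} {a, b}"
  obtains E' s where "E' \<subseteq> E" "is_spanning_tree N E'" "\<And>x. x \<in> N \<Longrightarrow> s x \<in> F x"
    "\<And>e. e \<in> E' \<Longrightarrow> P e (s ` e)"
proof -
  obtain r where r: "r \<in> N" using \<open>N \<noteq> {}\<close> by blast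
  \<comment> \<open>The invariant of the growing tree: \<open>V\<close> is the set of vertices
    reached so far and \<open>s\<close> is a section on it. Starting from a merely connected graph
    \<open>E\<close> lets the same construction yield the existence of spanning trees.\<close>
  define good where "good V E' s \<longleftrightarrow> r \<in> V \<and> V \<subseteq> N \<and> E' \<subseteq> E \<and> is_spanning_tree V E' \<and>
    (\<forall>x\<in>V. s x \<in> F x) \<and> (\<forall>e\<in>E'. P e (s ` e))" for V E' s
  have "\<exists>V E' s. good V E' s \<and> card V = Suc n" if "n < card N" for n
    using that
  proof (induction n)
    case 0
    obtain a where "a \<in> F r" using ne[OF r] by blast
    moreover have "is_spanning_tree {r} {}"
      by (auto simp: is_spanning_tree_def graph_connected_def graph_cycle_def intro!: exI[of _ 0])
    ultimately have "good {r} {} (\<lambda>_. a)" using r by (auto simp: good_def)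
    then show ?case by fastforce
  next
    case (Suc n)
    then obtain V E' s where g: "good V E' s" and card: "card V = Suc n" by auto
    have "V \<subset> N" using g card Suc.prems by (auto simp: good_def)
    then obtain u v where uv: "u \<in> V" "v \<notin> V" "{u, v} \<in> E"
      using graph_connected_edge_leaving[OF con, of r V] g by (auto simp: good_def)
    obtain b where b: "b \<in> F v" "P {u, v} {s u, b}"
      using lift[OF uv(3), of "s u"] g uv(1) by (auto simp: good_def)
    have vN: "v \<in> N" using uv(3) EC complete_edges_subset_Pow[of N] by blast
    have "E' \<subseteq> complete_edges V" using g by (auto simp: good_def is_spanning_tree_def)
    then have sub: "e \<subseteq> V" if "e \<in> E'" for e using that complete_edges_subset_Pow by blast
    have "(s(v := b)) ` e = s ` e" if "e \<in> E'" for e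
      using sub[OF that] uv(2) by (intro image_cong) auto
    moreover have "(s(v := b)) ` {u, v} = {s u, b}" using uv by auto
    ultimately have "good (insert v V) (insert {u, v} E') (s(v := b))"
      using g uv b vN is_spanning_tree_insert_leaf[of V E' u v] by (auto simp: good_def)
    moreover have "card (insert v V) = Suc (Suc n)"
      using card uv(2) by (metis card.infinite card_insert_disjoint nat.distinct(1))
    ultimately show ?case by blast
  qed
  moreover have "card N > 0" using fin r by (auto simp: card_gt_0_iff)
  ultimately obtain V E' s where "good V E' s" "card V = card N"
    by (metis Suc_pred' diff_less zero_less_one)
  moreover from this have "V = N" using card_subset_eq[OF fin, of V] by (simp add: good_def)
  ultimately have "E' \<subseteq> E" "is_spanning_tree N E'" "\<And>x. x \<in> N \<Longrightarrow> s x \<in> F x"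
    "\<And>e. e \<in> E' \<Longrightarrow> P e (s ` e)"
    by (auto simp: good_def)
  then show thesis by (rule that)
qed


section \<open>Minimum spanning trees\<close>

lemma edge_weight_pair:
  assumes "\<And>x y. \<rho> x y = \<rho> y x"
  shows "edge_weight \<rho> {x, y} = \<rho> x y"
  unfolding edge_weight_def using assms by (intro the_equality) (auto simp: doubleton_eq_iff)

lemma finite_spanning_trees:
  assumes "finite N"
  shows "finite {E. is_spanning_tree N E}"
proof -
  have "{E. is_spanning_tree N E} \<subseteq> Pow (Pow N)"
    using complete_edges_subset_Pow[of N] by (auto simp: is_spanning_tree_def)
  then show ?thesis using assms by (meson finite_Pow_iff finite_subset)
qed

text \<open>An instance of the construction above with trivial fibres and a predicate that always
  holds: only the tree that it grows inside the complete graph is wanted.\<close>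

lemma spanning_tree_exists:
  assumes "finite N" "N \<noteq> {}"
  obtains E where "is_spanning_tree N E"
proof -
  have "(x, y) \<in> {(u, v). {u, v} \<in> complete_edges N}\<^sup>*" if "x \<in> N" "y \<in> N" for x y
  proof (cases "x = y")
    case False
    then have "(x, y) \<in> {(u, v). {u, v} \<in> complete_edges N}"
      using that by (auto simp: complete_edges_def)
    then show ?thesis by blast
  qed simp
  then have "graph_connected N (complete_edges N)" by (auto simp: graph_connected_def)
  then show thesis
    by (rule spanning_tree_with_section[where F = "\<lambda>_. UNIV :: unit set" and P = "\<lambda>_ _. True",
        OF assms(1) _ order_refl assms(2)]) (auto intro: that)
qed

lemma mst_weight_le:
  assumes "finite N" "is_spanning_tree N E"
  shows "mst_weight \<rho> N \<le> (\<Sum>e\<in>E. edge_weight \<rho> e)"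
proof -
  have "finite {\<Sum>e\<in>E. edge_weight \<rho> e | E. is_spanning_tree N E}"
    using finite_spanning_trees[OF assms(1)] by (rule finite_image_set)
  then show ?thesis unfolding mst_weight_def using assms(2) by (intro Min_le) auto
qed

lemma mst_weight_attained:
  assumes "finite N" "N \<noteq> {}"
  obtains E where "is_spanning_tree N E" "mst_weight \<rho> N = (\<Sum>e\<in>E. edge_weight \<rho> e)"
proof -
  let ?S = "{\<Sum>e\<in>E. edge_weight \<rho> e | E. is_spanning_tree N E}"
  have "finite ?S" using finite_spanning_trees[OF assms(1)] by (rule finite_image_set)
  moreover have "?S \<noteq> {}" using spanning_tree_exists[OF assms] by blast
  ultimately have "mst_weight \<rho> N \<in> ?S" unfolding mst_weight_def by (rule Min_in)
  then show thesis using that by blast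
qed

lemma spanning_tree_edgeE:
  assumes "is_spanning_tree N E" "e \<in> E"
  obtains x y where "e = {x, y}" "x \<in> N" "y \<in> N" "x \<noteq> y"
  using assms by (auto simp: is_spanning_tree_def complete_edges_def)

lemma finite_spanning_tree:
  assumes "finite N" "is_spanning_tree N E"
  shows "finite E"
  using assms complete_edges_subset_Pow[of N] unfolding is_spanning_tree_def
  by (meson finite_Pow_iff finite_subset)

lemma mst_weight_nonneg:
  assumes "finite N" "N \<noteq> {}" "\<And>x y. \<rho> x y = \<rho> y x"
    and "\<And>x y. x \<in> N \<Longrightarrow> y \<in> N \<Longrightarrow> 0 \<le> \<rho> x y"
  shows "0 \<le> mst_weight \<rho> N"
proof -
  obtain E where E: "is_spanning_tree N E" "mst_weight \<rho> N = (\<Sum>e\<in>E. edge_weight \<rho> e)"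
    using mst_weight_attained assms(1,2) by blast
  have "0 \<le> edge_weight \<rho> e" if "e \<in> E" for e
    using spanning_tree_edgeE[OF E(1) that] edge_weight_pair[of \<rho>, OF assms(3)] assms(4) by metis
  then show ?thesis unfolding E(2) by (rule sum_nonneg)
qed

lemma mst_weight_pos:
  assumes "finite N" "2 \<le> card N" "\<And>x y. \<rho> x y = \<rho> y x"
    and "\<And>x y. x \<in> N \<Longrightarrow> y \<in> N \<Longrightarrow> x \<noteq> y \<Longrightarrow> 0 < \<rho> x y"
  shows "0 < mst_weight \<rho> N"
proof -
  have "N \<noteq> {}" using assms(2) by auto
  then obtain E where E: "is_spanning_tree N E" "mst_weight \<rho> N = (\<Sum>e\<in>E. edge_weight \<rho> e)"
    using mst_weight_attained assms(1) by blast
  have "0 < edge_weight \<rho> e" if "e \<in> E" for e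
    using spanning_tree_edgeE[OF E(1) that] edge_weight_pair[of \<rho>, OF assms(3)] assms(4) by metis
  moreover have "E \<noteq> {}"
  proof
    assume "E = {}"
    then have "x = y" if "x \<in> N" "y \<in> N" for x y
      using E(1) that by (auto simp: is_spanning_tree_def graph_connected_def)
    then have "card N \<le> 1" using assms(1) by (simp add: card_le_Suc0_iff_eq)
    then show False using assms(2) by simp
  qed
  ultimately show ?thesis unfolding E(2) using finite_spanning_tree[OF assms(1) E(1)]
    by (intro sum_pos) auto
qed

text \<open>An injective \<open>p\<close> carries a minimum tree to a spanning tree of the image,
  with no edge longer than before. It is applied on a lift of a set, where the covering is
  injective.\<close>

lemma mst_weight_image_le:
  assumes fin: "finite N" and "N \<noteq> {}" and inj: "inj_on p N"
    and sym: "\<And>x y. \<rho> x y = \<rho> y x" "\<And>x y. \<sigma> x y = \<sigma> y x"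
    and le: "\<And>x y. x \<in> N \<Longrightarrow> y \<in> N \<Longrightarrow> \<sigma> (p x) (p y) \<le> \<rho> x y"
  shows "mst_weight \<sigma> (p ` N) \<le> mst_weight \<rho> N"
proof -
  obtain E where E: "is_spanning_tree N E" "mst_weight \<rho> N = (\<Sum>e\<in>E. edge_weight \<rho> e)"
    using mst_weight_attained fin \<open>N \<noteq> {}\<close> by blast
  have "E \<subseteq> Pow N" using E(1) complete_edges_subset_Pow unfolding is_spanning_tree_def by blast
  then have "mst_weight \<sigma> (p ` N) \<le> (\<Sum>e\<in>E. edge_weight \<sigma> (p ` e))"
    using mst_weight_le[of "p ` N" _ \<sigma>] is_spanning_tree_image[OF E(1) inj] fin
    by (metis finite_imageI inj sum_edges_image)
  also have "\<dots> \<le> (\<Sum>e\<in>E. edge_weight \<rho> e)"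
  proof (rule sum_mono)
    fix e assume "e \<in> E"
    then obtain x y where "e = {x, y}" "x \<in> N" "y \<in> N" by (rule spanning_tree_edgeE[OF E(1)])
    then show "edge_weight \<sigma> (p ` e) \<le> edge_weight \<rho> e"
      using le by (simp add: edge_weight_pair[of \<rho>, OF sym(1)] edge_weight_pair[of \<sigma>, OF sym(2)])
  qed
  finally show ?thesis using E(2) by simp
qed

text \<open>The fibres of \<open>p\<close> are the admissible values of the section, and each edge
  of a minimum tree may grow by a fixed share of \<epsilon>.\<close>

lemma mst_weight_lift:
  assumes fin: "finite N" and "N \<noteq> {}" and NY: "N \<subseteq> p ` X"
    and sym: "\<And>x y. \<rho> x y = \<rho> y x" "\<And>x y. \<sigma> x y = \<sigma> y x"
    and nonneg: "\<And>x y. x \<in> N \<Longrightarrow> y \<in> N \<Longrightarrow> 0 \<le> \<sigma> x y"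
    and lift: "\<And>x y \<epsilon>. x \<in> X \<Longrightarrow> y \<in> p ` X \<Longrightarrow> 0 < \<epsilon> \<Longrightarrow>
      \<exists>x'\<in>X. p x' = y \<and> \<rho> x x' \<le> \<sigma> (p x) y + \<epsilon>"
    and "0 < \<epsilon>"
  obtains s where "s ` N \<subseteq> X" "\<And>x. x \<in> N \<Longrightarrow> p (s x) = x"
    "mst_weight \<rho> (s ` N) \<le> mst_weight \<sigma> N + \<epsilon>"
proof -
  obtain E where E: "is_spanning_tree N E" "mst_weight \<sigma> N = (\<Sum>e\<in>E. edge_weight \<sigma> e)"
    using mst_weight_attained fin \<open>N \<noteq> {}\<close> by blast
  have finE: "finite E" by (rule finite_spanning_tree[OF fin E(1)])
  \<comment> \<open>An equal share for each edge; the added 1 keeps the denominator positive when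
    \<open>N\<close> is a single point and \<open>E\<close> is empty.\<close>
  define \<delta> where "\<delta> = \<epsilon> / (real (card E) + 1)"
  have \<delta>: "0 < \<delta>" using \<open>0 < \<epsilon>\<close> by (simp add: \<delta>_def)
  note w\<rho> = edge_weight_pair[of \<rho>, OF sym(1)] and w\<sigma> = edge_weight_pair[of \<sigma>, OF sym(2)]
  have con: "graph_connected N E" and EC: "E \<subseteq> complete_edges N"
    using E(1) by (auto simp: is_spanning_tree_def)
  have "\<exists>b\<in>{b \<in> X. p b = y}. edge_weight \<rho> {a, b} \<le> edge_weight \<sigma> {x, y} + \<delta>"
    if "{x, y} \<in> E" "a \<in> {a \<in> X. p a = x}" for x y a
  proof -
    have "{x, y} \<subseteq> N" using that(1) EC complete_edges_subset_Pow[of N] by blast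
    then have "y \<in> p ` X" using NY by blast
    then show ?thesis using lift[OF _ _ \<delta>, of a y] that(2) by (auto simp: w\<rho> w\<sigma>)
  qed
  moreover have "{a \<in> X. p a = x} \<noteq> {}" if "x \<in> N" for x using that NY by auto
  ultimately obtain E' s where s: "E' \<subseteq> E" "is_spanning_tree N E'"
      "\<And>x. x \<in> N \<Longrightarrow> s x \<in> {a \<in> X. p a = x}"
      "\<And>e. e \<in> E' \<Longrightarrow> edge_weight \<rho> (s ` e) \<le> edge_weight \<sigma> e + \<delta>"
    using spanning_tree_with_section[OF fin con EC \<open>N \<noteq> {}\<close>,
        where F = "\<lambda>x. {a \<in> X. p a = x}" and P = "\<lambda>e e'. edge_weight \<rho> e' \<le> edge_weight \<sigma> e + \<delta>"]
    by blast
  have inj: "inj_on s N" using s(3) by (intro inj_on_inverseI[where g = p]) auto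
  have "E' \<subseteq> Pow N" using s(1) EC complete_edges_subset_Pow[of N] by blast
  then have "mst_weight \<rho> (s ` N) \<le> (\<Sum>e\<in>E'. edge_weight \<rho> (s ` e))"
    using mst_weight_le[of "s ` N" _ \<rho>] is_spanning_tree_image[OF s(2) inj] fin
    by (metis finite_imageI inj sum_edges_image)
  also have "\<dots> \<le> (\<Sum>e\<in>E'. edge_weight \<sigma> e + \<delta>)" using s(4) by (rule sum_mono)
  \<comment> \<open>The section lemma only promises \<open>E' \<subseteq> E\<close>; edges that were
    left out are restored because their terms are nonnegative.\<close>
  also have "\<dots> \<le> (\<Sum>e\<in>E. edge_weight \<sigma> e + \<delta>)"
  proof (rule sum_mono2[OF finE s(1)])
    fix e assume "e \<in> E - E'"
    then have "e \<in> E" by simp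
    then obtain x y where "e = {x, y}" "x \<in> N" "y \<in> N" by (rule spanning_tree_edgeE[OF E(1)])
    then show "0 \<le> edge_weight \<sigma> e + \<delta>" using nonneg[of x y] \<delta> by (simp add: w\<sigma>)
  qed
  also have "\<dots> = mst_weight \<sigma> N + card E * \<delta>" by (simp add: E(2) sum.distrib)
  also have "\<dots> \<le> mst_weight \<sigma> N + \<epsilon>" using \<open>0 < \<epsilon>\<close> by (simp add: \<delta>_def field_simps)
  finally have "mst_weight \<rho> (s ` N) \<le> mst_weight \<sigma> N + \<epsilon>" .
  moreover have "s ` N \<subseteq> X" "\<And>x. x \<in> N \<Longrightarrow> p (s x) = x" using s(3) by auto
  ultimately show thesis using that by blast
qed

section \<open>Steiner weights and the comparison of Steiner ratios\<close>

lemma smt_weight_nonneg: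
  assumes "finite N" "N \<noteq> {}" "N \<subseteq> X" "\<And>x y. \<rho> x y = \<rho> y x"
    and "\<And>x y. x \<in> X \<Longrightarrow> y \<in> X \<Longrightarrow> 0 \<le> \<rho> x y"
  shows "0 \<le> smt_weight X \<rho> N"
  unfolding smt_weight_def
proof (rule cInf_greatest)
  show "{mst_weight \<rho> N' |N'. finite N' \<and> N \<subseteq> N' \<and> N' \<subseteq> X} \<noteq> {}"
    using assms(1,3) by blast
  fix r assume "r \<in> {mst_weight \<rho> N' |N'. finite N' \<and> N \<subseteq> N' \<and> N' \<subseteq> X}"
  then obtain K where K: "r = mst_weight \<rho> K" "finite K" "N \<subseteq> K" "K \<subseteq> X" by blast
  have "K \<noteq> {}" using K(3) assms(2) by blast
  then show "0 \<le> r" unfolding K(1)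
    by (rule mst_weight_nonneg[OF K(2) _ assms(4,5)]) (use K(4) in blast)+
qed

lemma smt_weight_le:
  assumes "finite N'" "N \<subseteq> N'" "N' \<subseteq> X" "N \<noteq> {}" "\<And>x y. \<rho> x y = \<rho> y x"
    and "\<And>x y. x \<in> X \<Longrightarrow> y \<in> X \<Longrightarrow> 0 \<le> \<rho> x y"
  shows "smt_weight X \<rho> N \<le> mst_weight \<rho> N'"
  unfolding smt_weight_def
proof (rule cInf_lower)
  show "bdd_below {mst_weight \<rho> N' |N'. finite N' \<and> N \<subseteq> N' \<and> N' \<subseteq> X}"
  proof (rule bdd_belowI[where m = 0])
    fix r assume "r \<in> {mst_weight \<rho> N' |N'. finite N' \<and> N \<subseteq> N' \<and> N' \<subseteq> X}"
    then obtain K where K: "r = mst_weight \<rho> K" "finite K" "N \<subseteq> K" "K \<subseteq> X" by blast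
    have "K \<noteq> {}" using K(3) assms(4) by blast
    then show "0 \<le> r" unfolding K(1)
      by (rule mst_weight_nonneg[OF K(2) _ assms(5,6)]) (use K(4) in blast)+
  qed
qed (use assms(1-3) in blast)

theorem steiner_ratio_le_of_lifting:
  assumes sym: "\<And>x y. \<rho> x y = \<rho> y x" "\<And>x y. \<sigma> x y = \<sigma> y x"
    and pos: "\<And>x y. x \<in> p ` X \<Longrightarrow> y \<in> p ` X \<Longrightarrow> x \<noteq> y \<Longrightarrow> 0 < \<sigma> x y"
    and nonneg: "\<And>x y. x \<in> p ` X \<Longrightarrow> y \<in> p ` X \<Longrightarrow> 0 \<le> \<sigma> x y"
    and lip: "\<And>x y. x \<in> X \<Longrightarrow> y \<in> X \<Longrightarrow> \<sigma> (p x) (p y) \<le> \<rho> x y"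
    and lift: "\<And>x y \<epsilon>. x \<in> X \<Longrightarrow> y \<in> p ` X \<Longrightarrow> 0 < \<epsilon> \<Longrightarrow>
      \<exists>x'\<in>X. p x' = y \<and> \<rho> x x' \<le> \<sigma> (p x) y + \<epsilon>"
    and two: "\<exists>a\<in>p ` X. \<exists>b\<in>p ` X. a \<noteq> b"
  shows "steiner_ratio X \<rho> \<le> steiner_ratio (p ` X) \<sigma>"
proof -
  have nonneg': "0 \<le> \<rho> x y" if "x \<in> X" "y \<in> X" for x y
    using lip[OF that] nonneg that by (meson imageI order_trans)
  let ?m = "steiner_ratio X \<rho>"
  have m_le: "?m \<le> smt_weight X \<rho> K / mst_weight \<rho> K" if "finite K" "K \<subseteq> X" "2 \<le> card K" for K
    unfolding steiner_ratio_def
  proof (rule cInf_lower)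
    show "bdd_below {smt_weight X \<rho> N / mst_weight \<rho> N |N. finite N \<and> N \<subseteq> X \<and> 2 \<le> card N}"
    proof (rule bdd_belowI[where m = 0], clarify)
      fix N assume N: "finite N" "N \<subseteq> X" "2 \<le> card N"
      then have "N \<noteq> {}" by auto
      then show "0 \<le> smt_weight X \<rho> N / mst_weight \<rho> N"
        using smt_weight_nonneg[OF N(1) _ N(2) sym(1) nonneg']
          mst_weight_nonneg[OF N(1) _ sym(1)] nonneg' N(2)
        by (simp add: subset_iff)
    qed
  qed (use that in blast)
  \<comment> \<open>The inequality without quotients, for one competitor \<open>N'\<close> and one
    error \<epsilon>. Below, \<epsilon> is removed for each \<open>N'\<close>, which bounds the
    infimum over all \<open>N'\<close>.\<close>
  have main: "?m * mst_weight \<sigma> N \<le> mst_weight \<sigma> N' + \<epsilon>"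
    if N: "finite N'" "N \<subseteq> N'" "N' \<subseteq> p ` X" "2 \<le> card N" and \<epsilon>: "0 < \<epsilon>" for N N' \<epsilon>
  proof -
    have ne: "N \<noteq> {}" "N' \<noteq> {}" and finN: "finite N"
      using N finite_subset by auto
    \<comment> \<open>A single section over the whole of \<open>N'\<close>: restricted to
      \<open>N\<close>, it makes the lift of \<open>N'\<close> an admissible competitor for the lift
      of \<open>N\<close>.\<close>
    obtain s where s: "s ` N' \<subseteq> X" "\<And>x. x \<in> N' \<Longrightarrow> p (s x) = x"
        "mst_weight \<rho> (s ` N') \<le> mst_weight \<sigma> N' + \<epsilon>"
    proof (rule mst_weight_lift[of N' p X \<rho> \<sigma> \<epsilon>])
      show "0 \<le> \<sigma> x y" if "x \<in> N'" "y \<in> N'" for x y using that N(3) nonneg by blast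
    qed (use N ne(2) sym lift \<epsilon> in blast)+
    have inj: "inj_on s N" using s(2) N(2) by (intro inj_on_inverseI[where g = p]) auto
    have ps: "p ` s ` N = N" using s(2) N(2) by force
    have sN: "s ` N \<subseteq> X" "finite (s ` N)" "s ` N \<noteq> {}" "2 \<le> card (s ` N)"
      using s(1) N finN ne inj by (auto simp: card_image)
    have "inj_on p (s ` N)" using s(2) N(2) by (intro inj_on_inverseI[where g = s]) auto
    then have "mst_weight \<sigma> N \<le> mst_weight \<rho> (s ` N)"
      using mst_weight_image_le[of "s ` N" p \<rho> \<sigma>, OF sN(2,3) _ sym] lip sN(1)
      unfolding ps by blast
    moreover have pos': "0 < mst_weight \<sigma> N"
      by (rule mst_weight_pos[OF finN N(4) sym(2) pos]) (use N in auto)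
    moreover have "0 \<le> smt_weight X \<rho> (s ` N)"
      by (rule smt_weight_nonneg[OF sN(2,3,1) sym(1) nonneg'])
    \<comment> \<open>The minimum tree of the lift is at least as heavy as that of \<open>N\<close>,
      and replacing it by the smaller denominator can only enlarge a nonnegative quotient.\<close>
    ultimately have "smt_weight X \<rho> (s ` N) / mst_weight \<rho> (s ` N)
        \<le> smt_weight X \<rho> (s ` N) / mst_weight \<sigma> N"
      by (intro divide_left_mono) auto
    with m_le[of "s ` N"] sN have "?m \<le> smt_weight X \<rho> (s ` N) / mst_weight \<sigma> N" by linarith
    then have "?m * mst_weight \<sigma> N \<le> smt_weight X \<rho> (s ` N)" using pos' by (simp add: field_simps)
    also have "\<dots> \<le> mst_weight \<rho> (s ` N')"
      by (rule smt_weight_le[OF finite_imageI[OF N(1)] image_mono[OF N(2)] s(1) sN(3) sym(1) nonneg'])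
    also note s(3)
    finally show ?thesis .
  qed
  have "?m \<le> smt_weight (p ` X) \<sigma> N / mst_weight \<sigma> N"
    if N: "finite N" "N \<subseteq> p ` X" "2 \<le> card N" for N
  proof -
    have "0 < mst_weight \<sigma> N" 
      by (rule mst_weight_pos[OF N(1,3) sym(2) pos]) (use N in auto)
    moreover have "?m * mst_weight \<sigma> N \<le> smt_weight (p ` X) \<sigma> N"
      unfolding smt_weight_def
    proof (rule cInf_greatest)
      show "{mst_weight \<sigma> N' |N'. finite N' \<and> N \<subseteq> N' \<and> N' \<subseteq> p ` X} \<noteq> {}" using N by blast
    next
      fix r assume "r \<in> {mst_weight \<sigma> N' |N'. finite N' \<and> N \<subseteq> N' \<and> N' \<subseteq> p ` X}"
      then show "?m * mst_weight \<sigma> N \<le> r"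
        using main N(3) by (auto intro: field_le_epsilon)
    qed
    ultimately show ?thesis by (simp add: field_simps)
  qed
  \<comment> \<open>A lower bound for all ratios bounds their infimum only if there is a ratio at
    all; two distinct points of the base provide one.\<close>
  moreover have "\<exists>N. finite N \<and> N \<subseteq> p ` X \<and> 2 \<le> card N"
  proof -
    obtain a b where "a \<in> p ` X" "b \<in> p ` X" "a \<noteq> b" using two by blast
    then show ?thesis by (intro exI[of _ "{a, b}"]) auto
  qed
  ultimately show ?thesis
    unfolding steiner_ratio_def[of "p ` X"] by (intro cInf_greatest) auto
qed

section \<open>Calculus of smooth maps\<close>

lemma Ck_on_subset: "Ck_on k S f \<Longrightarrow> T \<subseteq> S \<Longrightarrow> Ck_on k T f"
  by (induction k arbitrary: f) (auto intro: continuous_on_subset)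

lemma Ck_on_SucD: "Ck_on (Suc k) S f \<Longrightarrow> Ck_on k S f"
proof (induction k arbitrary: f)
  case 0
  then show ?case
    by (auto intro!: continuous_at_imp_continuous_on differentiable_imp_continuous_within)
next
  case (Suc k)
  then show ?case by (metis Ck_on.simps(2))
qed

text \<open>The derivatives in \<open>Ck_on\<close> are taken \<open>at x\<close> and not within
  \<open>S\<close>, so agreement on \<open>S\<close> determines them because \<open>S\<close> is
  open.\<close>

lemma Ck_on_cong:
  assumes "open S" "\<And>x. x \<in> S \<Longrightarrow> f x = g x" "Ck_on k S f"
  shows "Ck_on k S g"
  using assms(2,3)
proof (induction k arbitrary: f g)
  case 0
  then show ?case using continuous_on_cong by force
next
  case (Suc k)
  have d: "f differentiable (at x)" if "x \<in> S" for x using Suc.prems that by simp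
  have "g differentiable (at x)" if "x \<in> S" for x
    using d[OF that] assms(1) that Suc.prems(1) unfolding differentiable_def
    by (blast intro: has_derivative_transform_within_open)
  moreover have "Ck_on k S (\<lambda>x. frechet_derivative g (at x) v)" for v
  proof (rule Suc.IH)
    show "Ck_on k S (\<lambda>x. frechet_derivative f (at x) v)" using Suc.prems(2) by simp
    show "frechet_derivative f (at x) v = frechet_derivative g (at x) v" if "x \<in> S" for x
      using frechet_derivative_transform_within_open[OF d[OF that] assms(1) that Suc.prems(1)] by simp
  qed
  ultimately show ?case by simp
qed

text \<open>\<open>frechet_derivative f (at x)\<close> does not refer to the set, so the local
  hypothesis passes to the directional derivatives and the induction applies to them.\<close>

lemma Ck_on_local:
  assumes "\<And>x. x \<in> S \<Longrightarrow> \<exists>T. open T \<and> x \<in> T \<and> Ck_on k T f"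
  shows "Ck_on k S f"
  using assms
proof (induction k arbitrary: f)
  case 0
  have "isCont f x" if "x \<in> S" for x
    using 0[OF that] continuous_on_eq_continuous_at by auto
  then show ?case by (simp add: continuous_at_imp_continuous_on)
next
  case (Suc k)
  have "f differentiable (at x)" if "x \<in> S" for x using Suc.prems[OF that] by auto
  moreover have "Ck_on k S (\<lambda>x. frechet_derivative f (at x) v)" for v
    using Suc.prems by (intro Suc.IH) force
  ultimately show ?case by simp
qed

lemma Ck_on_const: "Ck_on k S (\<lambda>_. c)"
proof (induction k arbitrary: c)
  case (Suc k)
  then show ?case by simp
qed simp

lemma Ck_on_add:
  assumes "open S" "Ck_on k S f" "Ck_on k S g"
  shows "Ck_on k S (\<lambda>x. f x + g x)"
  using assms(2,3)
proof (induction k arbitrary: f g)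
  case 0
  then show ?case by (simp add: continuous_on_add)
next
  case (Suc k)
  let ?D = "\<lambda>x v. frechet_derivative f (at x) v + frechet_derivative g (at x) v"
  have der: "((\<lambda>x. f x + g x) has_derivative ?D x) (at x)" if "x \<in> S" for x
    using Suc.prems that
    by (auto intro!: has_derivative_add simp: frechet_derivative_works[symmetric])
  have "Ck_on k S (\<lambda>x. frechet_derivative (\<lambda>x. f x + g x) (at x) v)" for v
  proof (rule Ck_on_cong[OF assms(1)])
    show "Ck_on k S (\<lambda>x. ?D x v)" using Suc by simp
    show "?D x v = frechet_derivative (\<lambda>x. f x + g x) (at x) v" if "x \<in> S" for x
      using frechet_derivative_at[OF der[OF that]] by metis
  qed
  then show ?case using der by (auto simp: differentiable_def)
qed

lemma Ck_on_sum:
  assumes "open S" "finite I" "\<And>i. i \<in> I \<Longrightarrow> Ck_on k S (f i)"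
  shows "Ck_on k S (\<lambda>x. \<Sum>i\<in>I. f i x)"
  using assms(2,3) by (induction I rule: finite_induct) (simp_all add: Ck_on_const Ck_on_add[OF assms(1)])

lemma Ck_on_bounded_linear_compose:
  assumes "open S" "bounded_linear L" "Ck_on k S f"
  shows "Ck_on k S (\<lambda>x. L (f x))"
  using assms(3)
proof (induction k arbitrary: f)
  case 0
  then show ?case using bounded_linear.continuous_on[OF assms(2)] by simp
next
  case (Suc k)
  have der: "((\<lambda>x. L (f x)) has_derivative (\<lambda>v. L (frechet_derivative f (at x) v))) (at x)"
    if "x \<in> S" for x
    using Suc.prems that
    by (auto intro!: bounded_linear.has_derivative[OF assms(2)] simp: frechet_derivative_works[symmetric])
  have "Ck_on k S (\<lambda>x. frechet_derivative (\<lambda>x. L (f x)) (at x) v)" for v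
  proof (rule Ck_on_cong[OF assms(1)])
    show "Ck_on k S (\<lambda>x. L (frechet_derivative f (at x) v))" using Suc by simp
    show "L (frechet_derivative f (at x) v) = frechet_derivative (\<lambda>x. L (f x)) (at x) v"
      if "x \<in> S" for x
      using frechet_derivative_at[OF der[OF that]] by metis
  qed
  then show ?case using der by (auto simp: differentiable_def)
qed

lemma Ck_on_scaleR:
  assumes "open S" "Ck_on k S a" "Ck_on k S f"
  shows "Ck_on k S (\<lambda>x. a x *\<^sub>R f x)"
  using assms(2,3)
proof (induction k arbitrary: a f)
  case 0
  then show ?case by (simp add: continuous_on_scaleR)
next
  case (Suc k)
  let ?D = "\<lambda>x v. a x *\<^sub>R frechet_derivative f (at x) v + frechet_derivative a (at x) v *\<^sub>R f x"
  have der: "((\<lambda>x. a x *\<^sub>R f x) has_derivative ?D x) (at x)" if "x \<in> S" for x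
    using Suc.prems that
    by (auto intro!: has_derivative_scaleR simp: frechet_derivative_works[symmetric])
  have "Ck_on k S (\<lambda>x. frechet_derivative (\<lambda>x. a x *\<^sub>R f x) (at x) v)" for v
  proof (rule Ck_on_cong[OF assms(1)])
    \<comment> \<open>Each term of the product rule pairs a derivative with an undifferentiated
      factor, whose order has to be lowered by one before the induction hypothesis fits.\<close>
    show "Ck_on k S (\<lambda>x. ?D x v)"
      using Suc.prems Ck_on_SucD[OF Suc.prems(1)] Ck_on_SucD[OF Suc.prems(2)]
      by (intro Ck_on_add[OF assms(1)] Suc.IH) simp_all
    show "?D x v = frechet_derivative (\<lambda>x. a x *\<^sub>R f x) (at x) v" if "x \<in> S" for x
      using frechet_derivative_at[OF der[OF that]] by metis
  qed
  then show ?case using der by (auto simp: differentiable_def)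
qed

text \<open>By the chain rule the derivative of the composition is that of \<open>f\<close> in the
  direction \<open>?Dg x v\<close>, which varies with \<open>x\<close>. Expanding this direction in
  the basis leaves products of scalar coefficients with directional derivatives of \<open>f\<close>,
  in fixed directions, composed with \<open>g\<close>. The induction hypothesis applies to these, so
  \<open>f\<close> is generalized and \<open>g\<close> stays fixed.\<close>

lemma Ck_on_compose:
  fixes g :: "'d::euclidean_space \<Rightarrow> 'e::euclidean_space"
  assumes "open T" "g ` T \<subseteq> S" "Ck_on k S f" "Ck_on k T g"
  shows "Ck_on k T (f \<circ> g)"
  using assms(3,4)
proof (induction k arbitrary: f)
  case 0
  then show ?case
    using continuous_on_compose[of T g f] continuous_on_subset[OF _ assms(2), of f] by simp
next
  case (Suc k)
  let ?Df = "\<lambda>x. frechet_derivative f (at x)" and ?Dg = "\<lambda>x. frechet_derivative g (at x)"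
  have df: "f differentiable (at (g x))" and dg: "g differentiable (at x)" if "x \<in> T" for x
    using Suc.prems assms(2) that by auto
  have "Ck_on k T (\<lambda>x. frechet_derivative (f \<circ> g) (at x) v)" for v
  proof (rule Ck_on_cong[OF assms(1)])
    show "Ck_on k T (\<lambda>x. \<Sum>b\<in>Basis. (?Dg x v \<bullet> b) *\<^sub>R (((\<lambda>y. ?Df y b) \<circ> g) x))"
    proof (intro Ck_on_sum[OF assms(1)] Ck_on_scaleR[OF assms(1)] Suc.IH)
      show "Ck_on k T (\<lambda>x. ?Dg x v \<bullet> b)" for b
        using Suc.prems(2) by (intro Ck_on_bounded_linear_compose[OF assms(1) bounded_linear_inner_left]) simp
      show "Ck_on k S (\<lambda>y. ?Df y b)" for b using Suc.prems(1) by simp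
      show "Ck_on k T g" by (rule Ck_on_SucD[OF Suc.prems(2)])
    qed simp
    show "(\<Sum>b\<in>Basis. (?Dg x v \<bullet> b) *\<^sub>R (((\<lambda>y. ?Df y b) \<circ> g) x)) = frechet_derivative (f \<circ> g) (at x) v"
      if "x \<in> T" for x
    proof -
      interpret Df: linear "?Df (g x)" using df[OF that] by (rule linear_frechet_derivative)
      have "?Df (g x) (?Dg x v) = ?Df (g x) (\<Sum>b\<in>Basis. (?Dg x v \<bullet> b) *\<^sub>R b)"
        by (simp add: euclidean_representation)
      then show ?thesis
        using frechet_derivative_compose[OF dg df] that by (simp add: Df.sum Df.scale)
    qed
  qed
  then show ?case using differentiable_chain_at[OF dg df] by (simp del: o_apply add: comp_def)
qed

lemma smooth_on_subset: "smooth_on S f \<Longrightarrow> T \<subseteq> S \<Longrightarrow> smooth_on T f"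
  unfolding smooth_on_def using Ck_on_subset by blast

lemma smooth_on_cong:
  assumes "open S" "\<And>x. x \<in> S \<Longrightarrow> f x = g x" "smooth_on S f"
  shows "smooth_on S g"
  using assms(3) Ck_on_cong[of S f g, OF assms(1,2)] by (simp add: smooth_on_def)

lemma smooth_on_local:
  assumes "\<And>x. x \<in> S \<Longrightarrow> \<exists>T. open T \<and> x \<in> T \<and> smooth_on T f"
  shows "smooth_on S f"
  unfolding smooth_on_def
proof (intro allI Ck_on_local)
  show "\<exists>T. open T \<and> x \<in> T \<and> Ck_on k T f" if "x \<in> S" for x k
    using assms[OF that] unfolding smooth_on_def by blast
qed

lemma smooth_on_compose:
  fixes g :: "'d::euclidean_space \<Rightarrow> 'e::euclidean_space"
  assumes "open T" "g ` T \<subseteq> S" "smooth_on S f" "smooth_on T g"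
  shows "smooth_on T (f \<circ> g)"
  unfolding smooth_on_def
proof
  show "Ck_on k T (f \<circ> g)" for k
    using assms(3,4) by (intro Ck_on_compose[OF assms(1,2)]) (simp_all add: smooth_on_def)
qed

text \<open>Covers the two parametrizations used later, straight segments in a chart and the
  reversal of time.\<close>

lemma smooth_on_affine:
  assumes "bounded_linear L"
  shows "smooth_on S (\<lambda>x. c + L x)"
proof -
  have der: "((\<lambda>x. c + L x) has_derivative L) (at x)" for x
    using bounded_linear_imp_has_derivative[OF assms] has_derivative_add[OF has_derivative_const, of L L]
    by simp
  have "Ck_on k S (\<lambda>x. c + L x)" for k
  proof (cases k)
    case 0
    then show ?thesis using assms by (simp add: continuous_intros linear_continuous_on)
  next
    case (Suc n)
    have "frechet_derivative (\<lambda>x. c + L x) (at x) = L" for x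
      using frechet_derivative_at[OF der] by metis
    then show ?thesis using der by (auto simp: Suc differentiable_def Ck_on_const)
  qed
  then show ?thesis by (simp add: smooth_on_def)
qed

lemma smooth_on_imp_Ck_on: "smooth_on S f \<Longrightarrow> Ck_on k S f"
  unfolding smooth_on_def by (rule spec)

lemma smooth_on_imp_differentiable: "smooth_on S f \<Longrightarrow> x \<in> S \<Longrightarrow> f differentiable (at x)"
  using smooth_on_imp_Ck_on[of S f "Suc 0"] by simp

lemma smooth_on_imp_continuous_on: "smooth_on S f \<Longrightarrow> continuous_on S f"
  using smooth_on_imp_Ck_on[of S f 0] by simp

lemma smooth_on_imp_continuous_vector_derivative:
  fixes f :: "real \<Rightarrow> 'e::euclidean_space"
  assumes "smooth_on S f"
  shows "continuous_on S (\<lambda>t. vector_derivative f (at t))"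
proof -
  have "continuous_on S (\<lambda>t. frechet_derivative f (at t) 1)"
    using smooth_on_imp_Ck_on[OF assms, of "Suc 0"] by simp
  moreover have "vector_derivative f (at t) = frechet_derivative f (at t) 1" if "t \<in> S" for t
  proof -
    have "(f has_derivative frechet_derivative f (at t)) (at t)"
      using smooth_on_imp_differentiable[OF assms that] by (simp add: frechet_derivative_works[symmetric])
    moreover from this interpret linear "frechet_derivative f (at t)" by (rule has_derivative_linear)
    have "frechet_derivative f (at t) = (\<lambda>x. x *\<^sub>R frechet_derivative f (at t) 1)"
    proof
      show "frechet_derivative f (at t) x = x *\<^sub>R frechet_derivative f (at t) 1" for x
        using scale[of x 1] by simp
    qed
    ultimately show ?thesis
      by (intro vector_derivative_at) (simp add: has_vector_derivative_def)
  qed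
  ultimately show ?thesis by (simp cong: continuous_on_cong)
qed

section \<open>Smooth curves in a Riemannian manifold\<close>

lemma open_vimage_openin:
  assumes "open J" "continuous_on J \<gamma>" "\<gamma> ` J \<subseteq> S" "openin (top_of_set S) U"
  shows "open (J \<inter> \<gamma> -` U)"
  using continuous_openin_preimage[OF assms(2) _ assms(4)] assms(1,3) openin_open_trans by blast

locale riem_manifold =
  fixes M :: "('a::topological_space, 'e::euclidean_space) riem"
  assumes manifold: "connected_riemannian_manifold M"
begin

abbreviation chart_inv :: "('a, 'e) chart \<Rightarrow> 'e \<Rightarrow> 'a" where
  "chart_inv c \<equiv> inv_into (fst c) (snd c)"

lemma atlas: "smooth_atlas (points M) (atlas M)" and riemannian: "riemannian_metric M"
  using manifold by (auto simp: connected_riemannian_manifold_def)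

lemma manifold_chart: "c \<in> atlas M \<Longrightarrow> manifold_chart (points M) c"
  using atlas by (auto simp: smooth_atlas_def)

lemma openin_chart: "c \<in> atlas M \<Longrightarrow> openin (top_of_set (points M)) (fst c)"
  and open_chart_image: "c \<in> atlas M \<Longrightarrow> open (snd c ` fst c)"
  using manifold_chart by (auto simp: manifold_chart_def)

lemma inj_on_chart: "c \<in> atlas M \<Longrightarrow> inj_on (snd c) (fst c)"
  using manifold_chart[of c] by (auto simp: manifold_chart_def homeomorphism_def intro: inj_on_inverseI)

text \<open>\<open>manifold_chart\<close> provides some inverse of the chart, while
  \<open>chart_rep\<close> is written with \<open>inv_into\<close>; on the image of the chart the
  two agree.\<close>

lemma homeomorphism_chart:
  assumes "c \<in> atlas M"
  shows "homeomorphism (fst c) (snd c ` fst c) (snd c) (chart_inv c)"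
proof -
  obtain \<psi> where \<psi>: "homeomorphism (fst c) (snd c ` fst c) (snd c) \<psi>"
    using manifold_chart[OF assms] by (auto simp: manifold_chart_def)
  have "chart_inv c y = \<psi> y" if "y \<in> snd c ` fst c" for y
    using that \<psi> inj_on_chart[OF assms] by (auto simp: homeomorphism_def)
  then show ?thesis by (intro homeomorphism_cong[OF \<psi>]) auto
qed

lemma continuous_on_chart: "c \<in> atlas M \<Longrightarrow> continuous_on (fst c) (snd c)"
  and continuous_on_chart_inv: "c \<in> atlas M \<Longrightarrow> continuous_on (snd c ` fst c) (chart_inv c)"
  using homeomorphism_chart by (auto simp: homeomorphism_def)

lemma chart_inv_chart [simp]: "c \<in> atlas M \<Longrightarrow> p \<in> fst c \<Longrightarrow> chart_inv c (snd c p) = p"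
  using inj_on_chart by simp

lemma chart_subset_points: "c \<in> atlas M \<Longrightarrow> fst c \<subseteq> points M"
  using openin_chart openin_imp_subset by blast

lemma chart_at:
  assumes "p \<in> points M"
  obtains c where "c \<in> atlas M" "p \<in> fst c"
  using assms atlas unfolding smooth_atlas_def by blast

lemma smooth_on_transition:
  "c \<in> atlas M \<Longrightarrow> d \<in> atlas M \<Longrightarrow> smooth_on (snd c ` (fst c \<inter> fst d)) (chart_rep c d id)"
  using atlas by (auto simp: smooth_atlas_def)

lemma bilinear_metric: "c \<in> atlas M \<Longrightarrow> p \<in> fst c \<Longrightarrow> bilinear (metric M c p)"
  and metric_pos: "c \<in> atlas M \<Longrightarrow> p \<in> fst c \<Longrightarrow> v \<noteq> 0 \<Longrightarrow> metric M c p v v > 0"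
  and smooth_on_metric: "c \<in> atlas M \<Longrightarrow> smooth_on (snd c ` fst c) (\<lambda>x. metric M c (chart_inv c x) u v)"
  using riemannian by (auto simp: riemannian_metric_def)

lemma metric_transition:
  assumes "c \<in> atlas M" "d \<in> atlas M" "p \<in> fst c \<inter> fst d"
  shows "metric M c p u v = metric M d p (frechet_derivative (chart_rep c d id) (at (snd c p)) u)
    (frechet_derivative (chart_rep c d id) (at (snd c p)) v)"
  using riemannian assms unfolding riemannian_metric_def Let_def by blast

lemma metric_nonneg:
  assumes "c \<in> atlas M" "p \<in> fst c"
  shows "0 \<le> metric M c p v v"
  using metric_pos[OF assms, of v] bilinear_lzero[OF bilinear_metric[OF assms]] by (cases "v = 0") auto

lemma metric_scale:
  assumes "c \<in> atlas M" "p \<in> fst c"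
  shows "metric M c p (r *\<^sub>R v) (r *\<^sub>R v) = r\<^sup>2 * metric M c p v v"
  by (simp add: bilinear_lmul[OF bilinear_metric[OF assms]] bilinear_rmul[OF bilinear_metric[OF assms]]
      power2_eq_square)

lemma metric_expand:
  assumes "c \<in> atlas M" "p \<in> fst c"
  shows "metric M c p u v = (\<Sum>i\<in>Basis. \<Sum>j\<in>Basis. (u \<bullet> i) * (v \<bullet> j) * metric M c p i j)"
proof -
  note b = bilinear_metric[OF assms]
  have "metric M c p u v = metric M c p (\<Sum>i\<in>Basis. (u \<bullet> i) *\<^sub>R i) (\<Sum>j\<in>Basis. (v \<bullet> j) *\<^sub>R j)"
    by (simp add: euclidean_representation)
  also have "\<dots> = (\<Sum>(i, j)\<in>Basis \<times> Basis. metric M c p ((u \<bullet> i) *\<^sub>R i) ((v \<bullet> j) *\<^sub>R j))"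
    by (rule bilinear_sum[OF b])
  finally show ?thesis
    by (simp add: sum.cartesian_product bilinear_lmul[OF b] bilinear_rmul[OF b] mult_ac)
qed

text \<open>The metric is given as smooth only on fixed pairs of vectors; expansion in the basis
  reduces a varying vector to its coefficients. This serves for the velocity of a curve and again on
  a compact set of unit vectors.\<close>

lemma continuous_on_metric:
  assumes c: "c \<in> atlas M" and q: "continuous_on X q" "q ` X \<subseteq> snd c ` fst c" and w: "continuous_on X w"
  shows "continuous_on X (\<lambda>x. metric M c (chart_inv c (q x)) (w x) (w x))"
proof -
  have "continuous_on X (\<lambda>x. metric M c (chart_inv c (q x)) i j)" for i j
    using continuous_on_compose2[OF smooth_on_imp_continuous_on[OF smooth_on_metric[OF c]] q] .
  then have "continuous_on X (\<lambda>x. \<Sum>i\<in>Basis. \<Sum>j\<in>Basis. (w x \<bullet> i) * (w x \<bullet> j) * metric M c (chart_inv c (q x)) i j)"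
    using w by (intro continuous_intros)
  moreover have "chart_inv c (q x) \<in> fst c" if "x \<in> X" for x
    using q(2) that by (meson image_subset_iff inv_into_into)
  ultimately show ?thesis using metric_expand[OF c] by (simp cong: continuous_on_cong)
qed

section \<open>Smooth curves in charts and their speed\<close>

lemma smooth_curve_subset: "smooth_curve M J \<gamma> \<Longrightarrow> I \<subseteq> J \<Longrightarrow> smooth_curve M I \<gamma>"
  unfolding smooth_curve_def
  by (meson Int_mono continuous_on_subset image_mono order_refl order_trans smooth_on_subset)

lemma open_smooth_curve_vimage:
  assumes "smooth_curve M J \<gamma>" "open J" "openin (top_of_set (points M)) U"
  shows "open (J \<inter> \<gamma> -` U)"
  using assms by (intro open_vimage_openin) (auto simp: smooth_curve_def)

lemma smooth_curve_smooth_on: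
  "smooth_curve M J \<gamma> \<Longrightarrow> c \<in> atlas M \<Longrightarrow> smooth_on (J \<inter> \<gamma> -` fst c) (snd c \<circ> \<gamma>)"
  by (simp add: smooth_curve_def)

lemma smooth_curve_cong:
  assumes \<gamma>: "smooth_curve M J \<gamma>" and J: "open J" and eq: "\<And>t. t \<in> J \<Longrightarrow> \<gamma> t = \<eta> t"
  shows "smooth_curve M J \<eta>"
proof -
  have "smooth_on (J \<inter> \<eta> -` fst c) (snd c \<circ> \<eta>)" if c: "c \<in> atlas M" for c
  proof -
    have *: "J \<inter> \<eta> -` fst c = J \<inter> \<gamma> -` fst c" using eq by auto
    show ?thesis unfolding *
      by (rule smooth_on_cong[OF open_smooth_curve_vimage[OF \<gamma> J openin_chart[OF c]] _
            smooth_curve_smooth_on[OF \<gamma> c]]) (simp add: eq)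
  qed
  moreover have "continuous_on J \<eta>" "\<eta> ` J \<subseteq> points M"
    using \<gamma> eq by (auto simp: smooth_curve_def cong: continuous_on_cong)
  ultimately show ?thesis by (simp add: smooth_curve_def)
qed

text \<open>Smoothness is local in the parameter, so local isometries and their inverses, which are
  available only near each point, can be used along a whole curve.\<close>

lemma smooth_curve_local:
  assumes "\<And>t. t \<in> J \<Longrightarrow> \<exists>I. open I \<and> t \<in> I \<and> smooth_curve M I \<gamma>"
  shows "smooth_curve M J \<gamma>"
proof -
  have "isCont \<gamma> t" "\<gamma> t \<in> points M" if "t \<in> J" for t
    using assms[OF that] by (auto simp: smooth_curve_def continuous_on_eq_continuous_at)
  moreover have "smooth_on (J \<inter> \<gamma> -` fst c) (snd c \<circ> \<gamma>)" if c: "c \<in> atlas M" for c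
  proof (rule smooth_on_local)
    fix t assume t: "t \<in> J \<inter> \<gamma> -` fst c"
    then obtain I where I: "open I" "t \<in> I" "smooth_curve M I \<gamma>" using assms by blast
    then show "\<exists>T. open T \<and> t \<in> T \<and> smooth_on T (snd c \<circ> \<gamma>)"
      using open_smooth_curve_vimage[OF I(3,1) openin_chart[OF c]] smooth_curve_smooth_on[OF I(3) c] t
      by blast
  qed
  ultimately show ?thesis by (auto simp: smooth_curve_def intro: continuous_at_imp_continuous_on)
qed

text \<open>Seen in any other chart \<open>d\<close>, the curve is \<open>q\<close> followed by a
  transition map.\<close>

lemma smooth_curve_chart_inv:
  assumes c: "c \<in> atlas M" and I: "open I" and q: "smooth_on I q" "q ` I \<subseteq> snd c ` fst c"
  shows "smooth_curve M I (chart_inv c \<circ> q)"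
proof -
  have into: "chart_inv c (q t) \<in> fst c" "snd c (chart_inv c (q t)) = q t" if "t \<in> I" for t
    using q(2) that by (meson image_subset_iff inv_into_into f_inv_into_f)+
  have cont: "continuous_on I (chart_inv c \<circ> q)"
    using smooth_on_imp_continuous_on[OF q(1)] continuous_on_subset[OF continuous_on_chart_inv[OF c] q(2)]
    by (rule continuous_on_compose)
  have img: "(chart_inv c \<circ> q) ` I \<subseteq> points M" using into chart_subset_points[OF c] by auto
  have "smooth_on (I \<inter> (chart_inv c \<circ> q) -` fst d) (snd d \<circ> (chart_inv c \<circ> q))" if d: "d \<in> atlas M" for d
  proof -
    let ?T = "I \<inter> (chart_inv c \<circ> q) -` fst d"
    have "open ?T" by (rule open_vimage_openin[OF I cont img openin_chart[OF d]])
    moreover have "q ` ?T \<subseteq> snd c ` (fst c \<inter> fst d)"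
    proof (rule image_subsetI)
      fix t assume "t \<in> ?T"
      then show "q t \<in> snd c ` (fst c \<inter> fst d)"
        using into[of t] by (intro image_eqI[of _ _ "chart_inv c (q t)"]) auto
    qed
    ultimately have "smooth_on ?T (chart_rep c d id \<circ> q)"
      using smooth_on_transition[OF c d] smooth_on_subset[OF q(1)] by (intro smooth_on_compose) auto
    then show ?thesis by (simp add: chart_rep_def comp_assoc)
  qed
  then show ?thesis using cont img by (simp add: smooth_curve_def)
qed

lemma smooth_curve_reparametrize:
  assumes \<gamma>: "smooth_curve M J \<gamma>" and I: "open I" and h: "smooth_on I h" "h ` I \<subseteq> J"
  shows "smooth_curve M I (\<gamma> \<circ> h)"
proof -
  have cont: "continuous_on I (\<gamma> \<circ> h)"
    using \<gamma> smooth_on_imp_continuous_on[OF h(1)] continuous_on_subset[OF _ h(2)]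
    by (intro continuous_on_compose) (auto simp: smooth_curve_def)
  have img: "(\<gamma> \<circ> h) ` I \<subseteq> points M" using \<gamma> h(2) by (auto simp: smooth_curve_def)
  have "smooth_on (I \<inter> (\<gamma> \<circ> h) -` fst c) (snd c \<circ> (\<gamma> \<circ> h))" if c: "c \<in> atlas M" for c
  proof -
    have "smooth_on (I \<inter> (\<gamma> \<circ> h) -` fst c) ((snd c \<circ> \<gamma>) \<circ> h)"
    proof (rule smooth_on_compose[OF _ _ smooth_curve_smooth_on[OF \<gamma> c]])
      show "open (I \<inter> (\<gamma> \<circ> h) -` fst c)" by (rule open_vimage_openin[OF I cont img openin_chart[OF c]])
      show "smooth_on (I \<inter> (\<gamma> \<circ> h) -` fst c) h" by (rule smooth_on_subset[OF h(1)]) auto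
    qed (use h(2) in auto)
    then show ?thesis by (simp add: comp_assoc)
  qed
  then show ?thesis using cont img by (simp add: smooth_curve_def)
qed

text \<open>The chain rule in coordinates. With \<open>f = id\<close> it relates the velocities in
  two charts, with a local isometry those of a curve and its image. The coordinate expressions agree
  only while the curve stays in the chart \<open>c\<close>, hence the restriction to an open set
  around \<open>t\<close>.\<close>

lemma velocity_chart_rep:
  assumes \<gamma>: "smooth_curve M J \<gamma>" and J: "open J" and t: "t \<in> J"
    and c: "c \<in> atlas M" "\<gamma> t \<in> fst c" and f: "chart_rep c d f differentiable (at (snd c (\<gamma> t)))"
  shows "vector_derivative (snd d \<circ> (f \<circ> \<gamma>)) (at t) =
    frechet_derivative (chart_rep c d f) (at (snd c (\<gamma> t))) (vector_derivative (snd c \<circ> \<gamma>) (at t))"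
proof (rule vector_derivative_at, rule has_vector_derivative_transform_within_open)
  let ?I = "J \<inter> \<gamma> -` fst c"
  show "open ?I" "t \<in> ?I"
    using open_smooth_curve_vimage[OF \<gamma> J openin_chart[OF c(1)]] t c(2) by auto
  have "(snd c \<circ> \<gamma>) differentiable (at t)"
    using smooth_on_imp_differentiable[OF smooth_curve_smooth_on[OF \<gamma> c(1)]] t c(2) by auto
  then have "((snd c \<circ> \<gamma>) has_vector_derivative vector_derivative (snd c \<circ> \<gamma>) (at t)) (at t)"
    by (simp add: vector_derivative_works[symmetric])
  moreover have "(chart_rep c d f has_derivative frechet_derivative (chart_rep c d f) (at (snd c (\<gamma> t))))
      (at ((snd c \<circ> \<gamma>) t))"
    using f by (simp add: frechet_derivative_works[symmetric])
  ultimately show "(chart_rep c d f \<circ> (snd c \<circ> \<gamma>) has_vector_derivative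
      frechet_derivative (chart_rep c d f) (at (snd c (\<gamma> t))) (vector_derivative (snd c \<circ> \<gamma>) (at t))) (at t)"
    using vector_derivative_diff_chain_within has_derivative_at_withinI by blast
  show "(chart_rep c d f \<circ> (snd c \<circ> \<gamma>)) s = (snd d \<circ> (f \<circ> \<gamma>)) s" if "s \<in> ?I" for s
    using that c(1) by (simp add: chart_rep_def)
qed

text \<open>Names the chart that the choice operator picks inside
  \<open>curve_speed\<close>.\<close>

definition chart_for :: "'a \<Rightarrow> ('a, 'e) chart" where
  "chart_for p = (SOME c. c \<in> atlas M \<and> p \<in> fst c)"

lemma chart_for: "p \<in> points M \<Longrightarrow> chart_for p \<in> atlas M" "p \<in> points M \<Longrightarrow> p \<in> fst (chart_for p)"
  unfolding chart_for_def
  by (rule someI2_ex[where P = "\<lambda>c. c \<in> atlas M \<and> p \<in> fst c"]; use chart_at in blast)+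

lemma curve_speed_chart_for:
  "curve_speed M \<gamma> t = sqrt (metric M (chart_for (\<gamma> t)) (\<gamma> t)
    (vector_derivative (snd (chart_for (\<gamma> t)) \<circ> \<gamma>) (at t))
    (vector_derivative (snd (chart_for (\<gamma> t)) \<circ> \<gamma>) (at t)))"
  by (simp add: curve_speed_def chart_for_def Let_def)

lemma curve_speed_nonneg: "\<gamma> t \<in> points M \<Longrightarrow> 0 \<le> curve_speed M \<gamma> t"
  using metric_nonneg chart_for by (auto simp: curve_speed_chart_for)

text \<open>Frees the speed from the chosen chart: the velocities in two charts correspond under the
  differential of the transition map, and the metric transforms by the same differential.\<close>

lemma curve_speed_chart:
  assumes \<gamma>: "smooth_curve M J \<gamma>" and J: "open J" and t: "t \<in> J" and c: "c \<in> atlas M" "\<gamma> t \<in> fst c"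
  shows "curve_speed M \<gamma> t = sqrt (metric M c (\<gamma> t)
    (vector_derivative (snd c \<circ> \<gamma>) (at t)) (vector_derivative (snd c \<circ> \<gamma>) (at t)))"
proof -
  let ?d = "chart_for (\<gamma> t)"
  have p: "\<gamma> t \<in> points M" using \<gamma> t by (auto simp: smooth_curve_def)
  note d = chart_for[OF p]
  have "chart_rep c ?d id differentiable (at (snd c (\<gamma> t)))"
    using smooth_on_imp_differentiable[OF smooth_on_transition[OF c(1) d(1)]] c(2) d(2) by blast
  from velocity_chart_rep[OF \<gamma> J t c this]
  have "vector_derivative (snd ?d \<circ> \<gamma>) (at t) = frechet_derivative (chart_rep c ?d id)
      (at (snd c (\<gamma> t))) (vector_derivative (snd c \<circ> \<gamma>) (at t))"
    by (simp only: id_o)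
  then show ?thesis
    using metric_transition[OF c(1) d(1), of "\<gamma> t"] c(2) d(2) by (simp only: curve_speed_chart_for IntI)
qed

lemma curve_speed_cong:
  assumes "open I" "t \<in> I" "\<And>s. s \<in> I \<Longrightarrow> \<gamma> s = \<eta> s"
  shows "curve_speed M \<gamma> t = curve_speed M \<eta> t"
proof -
  have "eventually (\<lambda>s. \<gamma> s = \<eta> s) (nhds t)"
    using assms by (auto simp: eventually_nhds)
  then have "vector_derivative (snd c \<circ> \<gamma>) (at t) = vector_derivative (snd c \<circ> \<eta>) (at t)" for c :: "('a, 'e) chart"
    by (intro vector_derivative_cong_eq) (auto elim: eventually_mono)
  then show ?thesis using assms(2,3) by (simp only: curve_speed_def)
qed

text \<open>The chart chosen in \<open>curve_speed\<close> may jump with the parameter, so near each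
  \<open>t\<close> the speed is first rewritten in one fixed chart.\<close>

lemma continuous_on_curve_speed:
  assumes \<gamma>: "smooth_curve M J \<gamma>" and J: "open J"
  shows "continuous_on J (curve_speed M \<gamma>)"
proof (rule continuous_at_imp_continuous_on, rule ballI)
  fix t assume t: "t \<in> J"
  then have "\<gamma> t \<in> points M" using \<gamma> by (auto simp: smooth_curve_def)
  then obtain c where c: "c \<in> atlas M" "\<gamma> t \<in> fst c" by (rule chart_at)
  let ?I = "J \<inter> \<gamma> -` fst c"
  have I: "open ?I" "t \<in> ?I"
    using open_smooth_curve_vimage[OF \<gamma> J openin_chart[OF c(1)]] t c(2) by auto
  note smooth = smooth_curve_smooth_on[OF \<gamma> c(1)]
  let ?v = "\<lambda>s. vector_derivative (snd c \<circ> \<gamma>) (at s)"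
  have "continuous_on ?I (\<lambda>s. metric M c (chart_inv c ((snd c \<circ> \<gamma>) s)) (?v s) (?v s))"
    using smooth_on_imp_continuous_on[OF smooth] smooth_on_imp_continuous_vector_derivative[OF smooth]
    by (intro continuous_on_metric[OF c(1)]) auto
  then have "continuous_on ?I (\<lambda>s. sqrt (metric M c (chart_inv c ((snd c \<circ> \<gamma>) s)) (?v s) (?v s)))"
    by (rule continuous_on_real_sqrt)
  moreover have "sqrt (metric M c (chart_inv c ((snd c \<circ> \<gamma>) s)) (?v s) (?v s)) = curve_speed M \<gamma> s"
    if "s \<in> ?I" for s
    using curve_speed_chart[OF \<gamma> J _ c(1), of s] that c(1) by simp
  ultimately have "continuous_on ?I (curve_speed M \<gamma>)" by (rule continuous_on_eq)
  then show "isCont (curve_speed M \<gamma>) t" using I by (simp add: continuous_on_eq_continuous_at)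
qed

text \<open>Reversal negates the velocity, and a quadratic form does not see the sign.\<close>

lemma curve_speed_reverse:
  assumes \<gamma>: "smooth_curve M J \<gamma>" and J: "open J" and t: "- t \<in> J"
  shows "curve_speed M (\<gamma> \<circ> uminus) t = curve_speed M \<gamma> (- t)"
proof -
  let ?c = "chart_for (\<gamma> (- t))"
  have "\<gamma> (- t) \<in> points M" using \<gamma> t by (auto simp: smooth_curve_def)
  note c = chart_for[OF this]
  have "(snd ?c \<circ> \<gamma>) differentiable (at (- t))"
    using smooth_on_imp_differentiable[OF smooth_curve_smooth_on[OF \<gamma> c(1)]] t c(2) by auto
  then have "((snd ?c \<circ> \<gamma>) has_vector_derivative vector_derivative (snd ?c \<circ> \<gamma>) (at (- t))) (at (- t))"
    by (simp add: vector_derivative_works[symmetric])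
  moreover have "(uminus has_vector_derivative - 1) (at t)"
    by (auto intro!: derivative_eq_intros)
  ultimately have "((snd ?c \<circ> \<gamma>) \<circ> uminus has_vector_derivative
      - 1 *\<^sub>R vector_derivative (snd ?c \<circ> \<gamma>) (at (- t))) (at t)"
    by (intro vector_diff_chain_at)
  then have "vector_derivative (snd ?c \<circ> (\<gamma> \<circ> uminus)) (at t) =
      - 1 *\<^sub>R vector_derivative (snd ?c \<circ> \<gamma>) (at (- t))"
    by (simp add: comp_assoc vector_derivative_at)
  then show ?thesis using metric_scale[OF c, of "- 1"] by (simp add: curve_speed_chart_for)
qed

end

section \<open>Piecewise smooth curves and their lengths\<close>

lemma continuous_on_Icc_combine:
  fixes \<gamma> :: "real \<Rightarrow> 'a::topological_space"
  assumes "continuous_on {a..b} \<gamma>" "continuous_on {b..c} \<gamma>" "a \<le> b" "b \<le> c"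
  shows "continuous_on {a..c} \<gamma>"
proof -
  have "{a..c} = {a..b} \<union> {b..c}" using assms by auto
  then show ?thesis using assms by (simp add: continuous_on_closed_Un)
qed

context riem_manifold
begin

lemma piecewise_smooth_curve_segment:
  assumes "s < t" "smooth_curve_segment M \<gamma> s t"
  shows "piecewise_smooth_curve M \<gamma> s t"
proof -
  obtain \<delta> \<eta> where \<eta>: "\<delta> > 0" "smooth_curve M {s - \<delta> <..< t + \<delta>} \<eta>" "\<And>u. u \<in> {s..t} \<Longrightarrow> \<eta> u = \<gamma> u"
    using assms(2) by (auto simp: smooth_curve_segment_def)
  have "{s..t} \<subseteq> {s - \<delta> <..< t + \<delta>}" using \<open>\<delta> > 0\<close> by auto
  from smooth_curve_subset[OF \<eta>(2) this] have "continuous_on {s..t} \<eta>" "\<eta> ` {s..t} \<subseteq> points M"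
    by (auto simp: smooth_curve_def)
  then have "continuous_on {s..t} \<gamma>" "\<gamma> ` {s..t} \<subseteq> points M"
    using continuous_on_eq[of "{s..t}" \<eta> \<gamma>] \<eta>(3) image_cong[of "{s..t}" "{s..t}" \<eta> \<gamma>] by simp_all
  moreover have "\<exists>n. \<exists>\<tau>::nat \<Rightarrow> real. \<tau> 0 = s \<and> \<tau> n = t \<and>
      (\<forall>i<n. \<tau> i < \<tau> (Suc i) \<and> smooth_curve_segment M \<gamma> (\<tau> i) (\<tau> (Suc i)))"
    using assms by (intro exI[of _ 1] exI[of _ "\<lambda>i. if i = 0 then s else t"]) auto
  ultimately show ?thesis using assms(1) by (simp add: piecewise_smooth_curve_def)
qed

lemma piecewise_smooth_curve_join:
  assumes ab: "piecewise_smooth_curve M \<gamma> a b" and bc: "piecewise_smooth_curve M \<gamma> b c"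
  shows "piecewise_smooth_curve M \<gamma> a c"
proof -
  obtain m \<sigma> where \<sigma>: "\<sigma> 0 = a" "\<sigma> m = b"
      "\<And>i. i < m \<Longrightarrow> \<sigma> i < \<sigma> (Suc i) \<and> smooth_curve_segment M \<gamma> (\<sigma> i) (\<sigma> (Suc i))"
    using ab by (auto simp: piecewise_smooth_curve_def)
  obtain n \<tau> where \<tau>: "\<tau> 0 = b" "\<tau> n = c"
      "\<And>i. i < n \<Longrightarrow> \<tau> i < \<tau> (Suc i) \<and> smooth_curve_segment M \<gamma> (\<tau> i) (\<tau> (Suc i))"
    using bc by (auto simp: piecewise_smooth_curve_def)
  \<comment> \<open>The subdivisions are concatenated; at index \<open>m\<close> both descriptions
    give \<open>b\<close>, since \<open>\<sigma> m = b = \<tau> 0\<close>.\<close>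
  define \<nu> where "\<nu> i = (if i \<le> m then \<sigma> i else \<tau> (i - m))" for i
  have "\<nu> i < \<nu> (Suc i) \<and> smooth_curve_segment M \<gamma> (\<nu> i) (\<nu> (Suc i))" if i: "i < m + n" for i
  proof (cases "i < m")
    case True
    then show ?thesis using \<sigma>(3)[OF True] by (simp add: \<nu>_def)
  next
    case False
    then have "\<nu> i = \<tau> (i - m)" "\<nu> (Suc i) = \<tau> (Suc (i - m))"
      using \<sigma>(2) \<tau>(1) by (auto simp: \<nu>_def Suc_diff_le)
    then show ?thesis using \<tau>(3)[of "i - m"] i False by simp
  qed
  moreover have "\<nu> 0 = a" "\<nu> (m + n) = c" using \<sigma> \<tau> by (auto simp: \<nu>_def)
  ultimately have part: "\<exists>n. \<exists>\<tau>::nat \<Rightarrow> real. \<tau> 0 = a \<and> \<tau> n = c \<and>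
      (\<forall>i<n. \<tau> i < \<tau> (Suc i) \<and> smooth_curve_segment M \<gamma> (\<tau> i) (\<tau> (Suc i)))"
    by (intro exI[of _ "m + n"] exI[of _ \<nu>]) blast
  have less: "a < b" "b < c" using ab bc by (auto simp: piecewise_smooth_curve_def)
  then have "{a..c} = {a..b} \<union> {b..c}" by auto
  then have "\<gamma> ` {a..c} \<subseteq> points M" using ab bc by (auto simp: piecewise_smooth_curve_def)
  moreover have "continuous_on {a..c} \<gamma>"
    using ab bc continuous_on_Icc_combine[of a b \<gamma> c] by (auto simp: piecewise_smooth_curve_def)
  ultimately show ?thesis using part less by (auto simp: piecewise_smooth_curve_def)
qed

text \<open>Hides the subdivision from later proofs: the curve stays fixed, only the interval
  varies, and a property has to hold on smooth pieces and survive the joining of adjacent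
  intervals.\<close>

lemma piecewise_smooth_curve_induct [consumes 1, case_names segment join]:
  assumes \<gamma>: "piecewise_smooth_curve M \<gamma> a b"
    and seg: "\<And>s t. s < t \<Longrightarrow> smooth_curve_segment M \<gamma> s t \<Longrightarrow> P s t"
    and join: "\<And>s t u. s < t \<Longrightarrow> t < u \<Longrightarrow> P s t \<Longrightarrow> P t u \<Longrightarrow> P s u"
  shows "P a b"
proof -
  obtain n \<tau> where \<tau>: "\<tau> 0 = a" "\<tau> n = b"
      "\<And>i. i < n \<Longrightarrow> \<tau> i < \<tau> (Suc i) \<and> smooth_curve_segment M \<gamma> (\<tau> i) (\<tau> (Suc i))"
    using \<gamma> by (auto simp: piecewise_smooth_curve_def)
  \<comment> \<open>\<open>k\<close> counts the pieces beyond the first; a subdivision without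
    pieces is excluded below by \<open>a \<noteq> b\<close>.\<close>
  have "\<tau> 0 < \<tau> (Suc k) \<and> P (\<tau> 0) (\<tau> (Suc k))" if "k < n" for k
    using that
  proof (induction k)
    case 0
    then show ?case using \<tau>(3)[OF 0] seg by blast
  next
    case (Suc k)
    then have "\<tau> 0 < \<tau> (Suc k)" "P (\<tau> 0) (\<tau> (Suc k))" by auto
    moreover have "\<tau> (Suc k) < \<tau> (Suc (Suc k))" "P (\<tau> (Suc k)) (\<tau> (Suc (Suc k)))"
      using \<tau>(3)[OF Suc.prems] seg by auto
    ultimately show ?case using join[of "\<tau> 0" "\<tau> (Suc k)" "\<tau> (Suc (Suc k))"] by linarith
  qed
  moreover have "a \<noteq> b" using \<gamma> by (simp add: piecewise_smooth_curve_def)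
  then obtain k where "n = Suc k" using \<tau>(1,2) by (cases n) auto
  ultimately show ?thesis using \<tau>(1,2) by blast
qed

lemma smooth_curve_segment_cong:
  assumes "smooth_curve_segment M \<gamma> s t" "\<And>u. u \<in> {s..t} \<Longrightarrow> \<gamma> u = \<eta> u"
  shows "smooth_curve_segment M \<eta> s t"
  using assms unfolding smooth_curve_segment_def by metis

lemma piecewise_smooth_curve_cong:
  assumes \<gamma>: "piecewise_smooth_curve M \<gamma> a b" and eq: "\<And>u. u \<in> {a..b} \<Longrightarrow> \<gamma> u = \<eta> u"
  shows "piecewise_smooth_curve M \<eta> a b"
proof -
  have "(\<forall>u\<in>{a..b}. \<gamma> u = \<eta> u) \<longrightarrow> piecewise_smooth_curve M \<eta> a b"
    using \<gamma>
  proof (induction rule: piecewise_smooth_curve_induct)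
    case (segment s t)
    then show ?case using piecewise_smooth_curve_segment smooth_curve_segment_cong by blast
  next
    case (join s t u)
    then show ?case using piecewise_smooth_curve_join[of \<eta> s t u] by auto
  qed
  then show ?thesis using eq by blast
qed

text \<open>The junction \<open>b\<close> becomes a breakpoint, so agreement of the two curves there
  is enough.\<close>

lemma piecewise_smooth_curve_glue:
  assumes \<gamma>: "piecewise_smooth_curve M \<gamma> a b" and \<eta>: "piecewise_smooth_curve M \<eta> b c"
    and "\<gamma> b = \<eta> b"
  shows "piecewise_smooth_curve M (\<lambda>u. if u \<le> b then \<gamma> u else \<eta> u) a c"
proof (rule piecewise_smooth_curve_join)
  show "piecewise_smooth_curve M (\<lambda>u. if u \<le> b then \<gamma> u else \<eta> u) a b"
    by (rule piecewise_smooth_curve_cong[OF \<gamma>]) simp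
  show "piecewise_smooth_curve M (\<lambda>u. if u \<le> b then \<gamma> u else \<eta> u) b c"
    by (rule piecewise_smooth_curve_cong[OF \<eta>]) (use \<open>\<gamma> b = \<eta> b\<close> in auto)
qed

text \<open>At \<open>s\<close> and \<open>t\<close> the smooth extension may continue differently
  from \<open>\<gamma>\<close>, hence the open interval.\<close>

lemma smooth_curve_segment_interior:
  assumes "smooth_curve_segment M \<gamma> s t"
  shows "smooth_curve M {s<..<t} \<gamma>"
proof -
  obtain \<delta> \<eta> where \<eta>: "\<delta> > 0" "smooth_curve M {s - \<delta> <..< t + \<delta>} \<eta>" "\<And>u. u \<in> {s..t} \<Longrightarrow> \<eta> u = \<gamma> u"
    using assms by (auto simp: smooth_curve_segment_def)
  have "{s<..<t} \<subseteq> {s - \<delta> <..< t + \<delta>}" using \<open>\<delta> > 0\<close> by auto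
  from smooth_curve_subset[OF \<eta>(2) this] show ?thesis
    by (rule smooth_curve_cong) (use \<eta>(3) in auto)
qed

text \<open>Allows speeds to be compared pointwise, as integrals and the fundamental theorem of
  calculus tolerate a finite exceptional set.\<close>

lemma piecewise_smooth_curve_smooth_off_finite:
  assumes "piecewise_smooth_curve M \<gamma> a b"
  obtains F where "finite F"
    "\<And>t. t \<in> {a..b} - F \<Longrightarrow> \<exists>I. open I \<and> t \<in> I \<and> smooth_curve M I \<gamma>"
proof -
  have "\<exists>F. finite F \<and> (\<forall>t\<in>{a..b} - F. \<exists>I. open I \<and> t \<in> I \<and> smooth_curve M I \<gamma>)"
    using assms
  proof (induction rule: piecewise_smooth_curve_induct)
    case (segment s t)
    have "\<exists>I. open I \<and> u \<in> I \<and> smooth_curve M I \<gamma>" if "u \<in> {s..t} - {s, t}" for u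
      using that smooth_curve_segment_interior[OF segment(2)] by (intro exI[of _ "{s<..<t}"]) auto
    then show ?case by (intro exI[of _ "{s, t}"]) blast
  next
    case (join s t u)
    then obtain F G where "finite F" "finite G"
      "\<forall>x\<in>{s..t} - F. \<exists>I. open I \<and> x \<in> I \<and> smooth_curve M I \<gamma>"
      "\<forall>x\<in>{t..u} - G. \<exists>I. open I \<and> x \<in> I \<and> smooth_curve M I \<gamma>" by blast
    moreover have "{s..u} \<subseteq> {s..t} \<union> {t..u}" by auto
    ultimately show ?case by (intro exI[of _ "F \<union> G"]) blast
  qed
  then show thesis using that by blast
qed

lemma curve_speed_integrable:
  assumes "piecewise_smooth_curve M \<gamma> a b"
  shows "curve_speed M \<gamma> integrable_on {a..b}"
  using assms
proof (induction rule: piecewise_smooth_curve_induct)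
  case (segment s t)
  then obtain \<delta> \<eta> where \<eta>: "\<delta> > 0" "smooth_curve M {s - \<delta> <..< t + \<delta>} \<eta>"
      "\<And>u. u \<in> {s..t} \<Longrightarrow> \<eta> u = \<gamma> u"
    by (auto simp: smooth_curve_segment_def)
  have "{s..t} \<subseteq> {s - \<delta> <..< t + \<delta>}" using \<open>\<delta> > 0\<close> by auto
  with continuous_on_curve_speed[OF \<eta>(2) open_greaterThanLessThan]
  have "continuous_on {s..t} (curve_speed M \<eta>)" by (rule continuous_on_subset)
  then have "curve_speed M \<eta> integrable_on {s..t}" by (rule integrable_continuous_interval)
  \<comment> \<open>The two-sided derivatives of \<open>\<gamma>\<close> and its extension may
    differ at the end points, which do not affect integrability.\<close>
  moreover have "curve_speed M \<gamma> u = curve_speed M \<eta> u" if "u \<in> {s..t} - {s, t}" for u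
    by (rule curve_speed_cong[of "{s<..<t}"]) (use that \<eta>(3) in auto)
  ultimately show ?case
    by (intro integrable_spike_finite[of "{s, t}" "{s..t}" "curve_speed M \<gamma>" "curve_speed M \<eta>"]) simp_all
next
  case (join s t u)
  show ?case
    by (rule Henstock_Kurzweil_Integration.integrable_combine[OF
          less_imp_le[OF join(1)] less_imp_le[OF join(2)] join(3,4)])
qed

lemma piecewise_smooth_curve_in_points:
  "piecewise_smooth_curve M \<gamma> a b \<Longrightarrow> t \<in> {a..b} \<Longrightarrow> \<gamma> t \<in> points M"
  by (auto simp: piecewise_smooth_curve_def)

lemma curve_length_nonneg:
  assumes "piecewise_smooth_curve M \<gamma> a b"
  shows "0 \<le> curve_length M \<gamma> a b"
  unfolding curve_length_def
  using piecewise_smooth_curve_in_points[OF assms] curve_speed_nonneg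
  by (intro integral_nonneg[OF curve_speed_integrable[OF assms]]) auto

lemma piecewise_smooth_curve_reverse:
  assumes "piecewise_smooth_curve M \<gamma> a b"
  shows "piecewise_smooth_curve M (\<gamma> \<circ> uminus) (- b) (- a)"
  using assms
proof (induction rule: piecewise_smooth_curve_induct)
  case (segment s t)
  then obtain \<delta> \<eta> where \<eta>: "\<delta> > 0" "smooth_curve M {s - \<delta> <..< t + \<delta>} \<eta>"
      "\<And>u. u \<in> {s..t} \<Longrightarrow> \<eta> u = \<gamma> u"
    by (auto simp: smooth_curve_segment_def)
  have lin: "bounded_linear (uminus :: real \<Rightarrow> real)"
    using bounded_linear_minus[OF bounded_linear_ident] .
  have "smooth_curve M {- t - \<delta> <..< - s + \<delta>} (\<eta> \<circ> uminus)"
  proof (rule smooth_curve_reparametrize[OF \<eta>(2)])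
    show "smooth_on {- t - \<delta> <..< - s + \<delta>} uminus"
      using smooth_on_affine[OF lin, of _ 0] by simp
  qed auto
  then have "smooth_curve_segment M (\<gamma> \<circ> uminus) (- t) (- s)"
    unfolding smooth_curve_segment_def using \<eta>(1,3)
    by (intro exI[of _ \<delta>] exI[of _ "\<eta> \<circ> uminus"]) auto
  then show ?case by (rule piecewise_smooth_curve_segment[rotated]) (use segment(1) in simp)
next
  case (join s t u)
  then show ?case by (blast intro: piecewise_smooth_curve_join)
qed

lemma curve_length_reverse:
  assumes "piecewise_smooth_curve M \<gamma> a b"
  shows "curve_length M (\<gamma> \<circ> uminus) (- b) (- a) = curve_length M \<gamma> a b"
proof -
  obtain F where F: "finite F" "\<And>t. t \<in> {a..b} - F \<Longrightarrow> \<exists>I. open I \<and> t \<in> I \<and> smooth_curve M I \<gamma>"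
    by (rule piecewise_smooth_curve_smooth_off_finite[OF assms]) blast
  have "integral {- b..- a} (curve_speed M (\<gamma> \<circ> uminus)) = integral {- b..- a} (\<lambda>t. curve_speed M \<gamma> (- t))"
  proof (rule integral_spike)
    show "negligible (uminus ` F)" using F(1) by (intro negligible_finite) simp
    show "curve_speed M \<gamma> (- t) = curve_speed M (\<gamma> \<circ> uminus) t" if "t \<in> {- b..- a} - uminus ` F" for t
    proof -
      have "- t \<in> {a..b} - F" using that by force
      then show ?thesis using F(2) curve_speed_reverse by metis
    qed
  qed
  then show ?thesis by (simp add: curve_length_def)
qed


section \<open>The distance of a connected Riemannian manifold\<close>

text \<open>Reversal of curves shows that the two sets of lengths are equal, so symmetry holds even
  where they are empty. The combinatorial lemmas ask for it in this unrestricted form.\<close>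

lemma riem_dist_sym: "riem_dist M x y = riem_dist M y x"
proof -
  have "{curve_length M \<gamma> a b | \<gamma> a b. piecewise_smooth_curve M \<gamma> a b \<and> \<gamma> a = x \<and> \<gamma> b = y}
    \<subseteq> {curve_length M \<gamma> a b | \<gamma> a b. piecewise_smooth_curve M \<gamma> a b \<and> \<gamma> a = y \<and> \<gamma> b = x}" for x y
  proof clarify
    fix \<gamma> a b assume \<gamma>: "piecewise_smooth_curve M \<gamma> a b" "x = \<gamma> a" "y = \<gamma> b"
    show "\<exists>\<eta> a' b'. curve_length M \<gamma> a b = curve_length M \<eta> a' b' \<and>
        piecewise_smooth_curve M \<eta> a' b' \<and> \<eta> a' = \<gamma> b \<and> \<eta> b' = \<gamma> a"
      using piecewise_smooth_curve_reverse[OF \<gamma>(1)] curve_length_reverse[OF \<gamma>(1)]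
      by (intro exI[of _ "\<gamma> \<circ> uminus"] exI[of _ "- b"] exI[of _ "- a"]) auto
  qed
  from subset_antisym[OF this this] show ?thesis unfolding riem_dist_def by (rule arg_cong)
qed

lemma bdd_below_curve_lengths:
  "bdd_below {curve_length M \<gamma> a b | \<gamma> a b. piecewise_smooth_curve M \<gamma> a b \<and> \<gamma> a = x \<and> \<gamma> b = y}"
  using curve_length_nonneg by (intro bdd_belowI[where m = 0]) auto

lemma riem_dist_le:
  assumes "piecewise_smooth_curve M \<gamma> a b"
  shows "riem_dist M (\<gamma> a) (\<gamma> b) \<le> curve_length M \<gamma> a b"
  unfolding riem_dist_def using assms by (intro cInf_lower bdd_below_curve_lengths) blast

text \<open>Points whose coordinates lie in a common ball are joined by the straight segment between
  them. The starting parameter \<open>b\<close> is left free so that the segment can continue a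
  curve ending at \<open>b\<close>.\<close>

lemma chart_segment:
  assumes "p \<in> points M"
  shows "\<exists>T. openin (top_of_set (points M)) T \<and> p \<in> T \<and>
    (\<forall>x\<in>T. \<forall>y\<in>T. \<forall>b. \<exists>\<gamma>. piecewise_smooth_curve M \<gamma> b (b + 1) \<and> \<gamma> b = x \<and> \<gamma> (b + 1) = y)"
proof -
  obtain c where c: "c \<in> atlas M" "p \<in> fst c" using chart_at[OF assms] .
  then obtain r where r: "r > 0" "ball (snd c p) r \<subseteq> snd c ` fst c"
    using open_chart_image[OF c(1)] by (meson imageI open_contains_ball)
  let ?B = "ball (snd c p) r"
  let ?T = "fst c \<inter> snd c -` ?B"
  have "openin (top_of_set (fst c)) ?T"
    using continuous_on_chart[OF c(1)] open_ball by (rule continuous_openin_preimage_gen)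
  then have "openin (top_of_set (points M)) ?T"
    using openin_chart[OF c(1)] by (rule openin_trans)
  moreover have "\<exists>\<gamma>. piecewise_smooth_curve M \<gamma> b (b + 1) \<and> \<gamma> b = x \<and> \<gamma> (b + 1) = y"
    if xy: "x \<in> ?T" "y \<in> ?T" for x y b
  proof -
    define q where "q t = snd c x + (t - b) *\<^sub>R (snd c y - snd c x)" for t :: real
    have q': "q = (\<lambda>t. (snd c x - b *\<^sub>R (snd c y - snd c x)) + t *\<^sub>R (snd c y - snd c x))"
      by (auto simp: q_def algebra_simps)
    have smooth: "smooth_on S q" for S unfolding q' by (intro smooth_on_affine bounded_linear_scaleR_left)
    have cont: "continuous_on UNIV q" by (rule smooth_on_imp_continuous_on[OF smooth])
    then have "open (q -` ?B)" by (simp add: open_vimage)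
    moreover have "q ` {b..b+1} \<subseteq> ?B"
    proof (rule image_subsetI)
      fix t assume "t \<in> {b..b+1}"
      moreover have "q t = (1 - (t - b)) *\<^sub>R snd c x + (t - b) *\<^sub>R snd c y"
        by (simp add: q_def algebra_simps)
      ultimately show "q t \<in> ?B"
        using convexD[OF convex_ball, of "snd c x" "snd c p" r "snd c y" "1 - (t - b)" "t - b"] xy by auto
    qed
    \<comment> \<open>Smoothness of a closed segment asks for an extension to an open interval;
      compactness of the segment gives it some room inside the ball.\<close>
    ultimately obtain \<epsilon> where \<epsilon>: "\<epsilon> > 0" "(\<Union>t\<in>{b..b+1}. ball t \<epsilon>) \<subseteq> q -` ?B"
      using compact_subset_open_imp_ball_epsilon_subset[of "{b..b+1}" "q -` ?B"] by blast
    have "q ` {b - \<epsilon> <..< b + 1 + \<epsilon>} \<subseteq> ?B"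
    proof (rule image_subsetI)
      fix t assume t: "t \<in> {b - \<epsilon> <..< b + 1 + \<epsilon>}"
      have "\<exists>s\<in>{b..b+1}. t \<in> ball s \<epsilon>"
        \<comment> \<open>The witness is the point of the closed interval nearest to
          \<open>t\<close>.\<close>
        using t \<epsilon>(1) by (intro bexI[of _ "max b (min t (b + 1))"]) (auto simp: dist_real_def)
      then show "q t \<in> ?B" using \<epsilon>(2) by blast
    qed
    then have "q ` {b - \<epsilon> <..< b + 1 + \<epsilon>} \<subseteq> snd c ` fst c" using r(2) by blast
    then have "smooth_curve M {b - \<epsilon> <..< b + 1 + \<epsilon>} (chart_inv c \<circ> q)"
      by (intro smooth_curve_chart_inv[OF c(1)] smooth) auto
    then have "smooth_curve_segment M (chart_inv c \<circ> q) b (b + 1)"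
      unfolding smooth_curve_segment_def using \<epsilon>(1) by blast
    then have "piecewise_smooth_curve M (chart_inv c \<circ> q) b (b + 1)"
      by (rule piecewise_smooth_curve_segment[rotated]) simp
    moreover have "(chart_inv c \<circ> q) b = x" "(chart_inv c \<circ> q) (b + 1) = y"
      using xy c(1) by (auto simp: q_def)
    ultimately show ?thesis by blast
  qed
  ultimately show ?thesis using c(2) r(1) by (intro exI[of _ ?T]) auto
qed

text \<open>By \<open>chart_segment\<close>, being reachable from \<open>x\<close> is a locally
  constant property, so it spreads over the connected manifold.\<close>

lemma piecewise_smooth_curve_exists:
  assumes x: "x \<in> points M" and y: "y \<in> points M"
  shows "\<exists>\<gamma> a b. piecewise_smooth_curve M \<gamma> a b \<and> \<gamma> a = x \<and> \<gamma> b = y"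
proof (rule connected_induction_simple[of "points M" x y])
  show "connected (points M)" using manifold by (simp add: connected_riemannian_manifold_def)
  show "\<exists>\<gamma> a b. piecewise_smooth_curve M \<gamma> a b \<and> \<gamma> a = x \<and> \<gamma> b = x"
    using chart_segment[OF x] by blast
  fix p assume "p \<in> points M"
  then obtain T where T: "openin (top_of_set (points M)) T" "p \<in> T"
    "\<And>u v b. u \<in> T \<Longrightarrow> v \<in> T \<Longrightarrow>
      \<exists>\<gamma>. piecewise_smooth_curve M \<gamma> b (b + 1) \<and> \<gamma> b = u \<and> \<gamma> (b + 1) = v"
    using chart_segment by meson
  have "\<exists>\<gamma> a b. piecewise_smooth_curve M \<gamma> a b \<and> \<gamma> a = x \<and> \<gamma> b = v"
    if uv: "u \<in> T" "v \<in> T" and \<gamma>: "piecewise_smooth_curve M \<gamma> a b" "\<gamma> a = x" "\<gamma> b = u" for u v \<gamma> a b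
  proof -
    obtain \<eta> where \<eta>: "piecewise_smooth_curve M \<eta> b (b + 1)" "\<eta> b = u" "\<eta> (b + 1) = v"
      using T(3)[OF uv] by blast
    have "a < b" using \<gamma>(1) by (simp add: piecewise_smooth_curve_def)
    then show ?thesis using piecewise_smooth_curve_glue[OF \<gamma>(1) \<eta>(1)] \<gamma> \<eta>
      by (intro exI[of _ "\<lambda>t. if t \<le> b then \<gamma> t else \<eta> t"] exI[of _ a] exI[of _ "b + 1"]) auto
  qed
  then show "\<exists>T. openin (top_of_set (points M)) T \<and> p \<in> T \<and> (\<forall>u\<in>T. \<forall>v\<in>T.
      (\<exists>\<gamma> a b. piecewise_smooth_curve M \<gamma> a b \<and> \<gamma> a = x \<and> \<gamma> b = u) \<longrightarrow>
      (\<exists>\<gamma> a b. piecewise_smooth_curve M \<gamma> a b \<and> \<gamma> a = x \<and> \<gamma> b = v))"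
    using T(1,2) by (intro exI[of _ T]) blast
qed (use x y in auto)

lemma curve_lengths_nonempty:
  assumes "x \<in> points M" "y \<in> points M"
  shows "{curve_length M \<gamma> a b | \<gamma> a b. piecewise_smooth_curve M \<gamma> a b \<and> \<gamma> a = x \<and> \<gamma> b = y} \<noteq> {}"
  using piecewise_smooth_curve_exists[OF assms] by blast

lemma riem_dist_greatest:
  assumes "x \<in> points M" "y \<in> points M"
    and "\<And>\<gamma> a b. piecewise_smooth_curve M \<gamma> a b \<Longrightarrow> \<gamma> a = x \<Longrightarrow> \<gamma> b = y \<Longrightarrow> l \<le> curve_length M \<gamma> a b"
  shows "l \<le> riem_dist M x y"
  unfolding riem_dist_def
  by (rule cInf_greatest[OF curve_lengths_nonempty[OF assms(1,2)]]) (use assms(3) in blast)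

lemma riem_dist_nonneg: "x \<in> points M \<Longrightarrow> y \<in> points M \<Longrightarrow> 0 \<le> riem_dist M x y"
  using riem_dist_greatest curve_length_nonneg by blast

lemma almost_minimizing_curve:
  assumes "x \<in> points M" "y \<in> points M" "0 < \<epsilon>"
  obtains \<gamma> a b where "piecewise_smooth_curve M \<gamma> a b" "\<gamma> a = x" "\<gamma> b = y"
    "curve_length M \<gamma> a b \<le> riem_dist M x y + \<epsilon>"
proof -
  have "\<exists>\<gamma> a b. piecewise_smooth_curve M \<gamma> a b \<and> \<gamma> a = x \<and> \<gamma> b = y \<and>
    curve_length M \<gamma> a b \<le> riem_dist M x y + \<epsilon>"
  proof (rule ccontr)
    assume no: "\<not> ?thesis"
    have "riem_dist M x y + \<epsilon> \<le> curve_length M \<gamma> a b"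
      if "piecewise_smooth_curve M \<gamma> a b" "\<gamma> a = x" "\<gamma> b = y" for \<gamma> a b
      using that no linear[of "riem_dist M x y + \<epsilon>" "curve_length M \<gamma> a b"] by blast
    then have "riem_dist M x y + \<epsilon> \<le> riem_dist M x y" by (rule riem_dist_greatest[OF assms(1,2)])
    then show False using \<open>0 < \<epsilon>\<close> by simp
  qed
  then show thesis using that by blast
qed

text \<open>The metric is continuous and positive on the compact product of \<open>C\<close> with
  the unit sphere, so it has a positive minimum there; homogeneity extends the bound to all
  vectors.\<close>

lemma metric_lower_bound:
  assumes c: "c \<in> atlas M" and C: "compact C" "C \<subseteq> snd c ` fst c"
  obtains \<kappa> where "0 < \<kappa>"
    "\<And>p v. p \<in> fst c \<Longrightarrow> snd c p \<in> C \<Longrightarrow> \<kappa> * norm v \<le> sqrt (metric M c p v v)"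
proof (cases "C = {}")
  case True
  then show thesis using that[of 1] by simp
next
  case False
  define g where "g x = metric M c (chart_inv c (fst x)) (snd x) (snd x)" for x :: "'e \<times> 'e"
  have "continuous_on (C \<times> sphere 0 1) g"
    unfolding g_def using C(2) by (intro continuous_on_metric[OF c] continuous_intros) auto
  moreover have "compact (C \<times> sphere (0::'e) 1)" using C(1) by (intro compact_Times) auto
  moreover have "C \<times> sphere (0::'e) 1 \<noteq> {}" using False by simp
  ultimately obtain z where z: "z \<in> C \<times> sphere 0 1" "\<And>x. x \<in> C \<times> sphere 0 1 \<Longrightarrow> g z \<le> g x"
    using continuous_attains_inf[of "C \<times> sphere (0::'e) 1" g] by blast
  have "fst z \<in> C" "norm (snd z) = 1" using z(1) by auto
  then have "chart_inv c (fst z) \<in> fst c" "snd z \<noteq> 0"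
    using C(2) by (auto intro: inv_into_into)
  then have pos: "0 < g z" unfolding g_def by (rule metric_pos[OF c])
  show thesis
  proof (rule that)
    show "0 < sqrt (g z)" using pos by simp
    fix p v assume p: "p \<in> fst c" "snd c p \<in> C"
    show "sqrt (g z) * norm v \<le> sqrt (metric M c p v v)"
    proof (cases "v = 0")
      case True
      then show ?thesis using metric_nonneg[OF c p(1)] by simp
    next
      case False
      define u where "u = v /\<^sub>R norm v"
      have "v = norm v *\<^sub>R u" "norm u = 1" using False by (auto simp: u_def)
      then have "metric M c p v v = (norm v)\<^sup>2 * metric M c p u u"
        using metric_scale[OF c p(1), of "norm v" u] by simp
      moreover have "g z \<le> metric M c p u u"
        using z(2)[of "(snd c p, u)"] p c \<open>norm u = 1\<close> by (simp add: g_def)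
      ultimately have "g z * (norm v)\<^sup>2 \<le> metric M c p v v"
        by (simp add: mult.commute mult_right_mono)
      then have "sqrt (g z * (norm v)\<^sup>2) \<le> sqrt (metric M c p v v)" by (rule real_sqrt_le_mono)
      then show ?thesis by (simp add: real_sqrt_mult)
    qed
  qed
qed

text \<open>The coordinate displacement up to \<open>t\<close> is the integral of the coordinate
  velocity, whose norm is at most the speed divided by \<kappa>. What follows after
  \<open>t\<close>, possibly outside the chart, can only add length.\<close>

lemma curve_length_lower_bound:
  assumes \<gamma>: "piecewise_smooth_curve M \<gamma> a b" and t: "t \<in> {a..b}"
    and c: "c \<in> atlas M" "\<gamma> ` {a..t} \<subseteq> fst c"
    and \<kappa>: "0 < \<kappa>" "\<And>s v. s \<in> {a..t} \<Longrightarrow> \<kappa> * norm v \<le> sqrt (metric M c (\<gamma> s) v v)"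
  shows "\<kappa> * dist (snd c (\<gamma> a)) (snd c (\<gamma> t)) \<le> curve_length M \<gamma> a b"
proof -
  obtain F where F: "finite F" "\<And>s. s \<in> {a..b} - F \<Longrightarrow> \<exists>I. open I \<and> s \<in> I \<and> smooth_curve M I \<gamma>"
    by (rule piecewise_smooth_curve_smooth_off_finite[OF \<gamma>]) blast
  let ?f = "snd c \<circ> \<gamma>"
  \<comment> \<open>The value 0 at the exceptional parameters makes the norm bound below hold at
    every parameter.\<close>
  define v where "v s = (if s \<in> F then 0 else vector_derivative ?f (at s))" for s
  have smooth: "?f differentiable (at s) \<and> curve_speed M \<gamma> s =
      sqrt (metric M c (\<gamma> s) (vector_derivative ?f (at s)) (vector_derivative ?f (at s)))"
    if s: "s \<in> {a..t} - F" for s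
  proof -
    have "s \<in> {a..b} - F" using s t by auto
    then obtain I where I: "open I" "s \<in> I" "smooth_curve M I \<gamma>" using F(2) by blast
    have "\<gamma> s \<in> fst c" using c(2) s by blast
    then show ?thesis
      using smooth_on_imp_differentiable[OF smooth_curve_smooth_on[OF I(3) c(1)]]
        curve_speed_chart[OF I(3,1,2) c(1)] I(2) by blast
  qed
  have "continuous_on {a..b} \<gamma>" using \<gamma> by (simp add: piecewise_smooth_curve_def)
  then have "continuous_on {a..t} \<gamma>" by (rule continuous_on_subset) (use t in auto)
  then have "continuous_on {a..t} ?f"
    by (rule continuous_on_compose) (rule continuous_on_subset[OF continuous_on_chart[OF c(1)] c(2)])
  then have hi: "(v has_integral ?f t - ?f a) {a..t}"
  proof (intro fundamental_theorem_of_calculus_interior_strong[OF F(1)])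
    show "a \<le> t" using t by simp
    show "(?f has_vector_derivative v s) (at s)" if "s \<in> {a<..<t} - F" for s
      using smooth[of s] that by (simp add: v_def vector_derivative_works[symmetric])
  qed
  have int: "curve_speed M \<gamma> integrable_on {a..b}" by (rule curve_speed_integrable[OF \<gamma>])
  then have int_t: "curve_speed M \<gamma> integrable_on {a..t}"
    by (rule integrable_on_subinterval) (use t in auto)
  have nonneg: "0 \<le> curve_speed M \<gamma> s" if "s \<in> {a..b}" for s
    using piecewise_smooth_curve_in_points[OF \<gamma> that] by (rule curve_speed_nonneg)
  have "norm (integral {a..t} v) \<le> integral {a..t} (\<lambda>s. (1 / \<kappa>) * curve_speed M \<gamma> s)"
  proof (rule integral_norm_bound_integral)
    show "v integrable_on {a..t}" using hi by blast
    show "(\<lambda>s. (1 / \<kappa>) * curve_speed M \<gamma> s) integrable_on {a..t}"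
      using int_t by (rule integrable_on_mult_right)
    fix s assume s: "s \<in> {a..t}"
    show "norm (v s) \<le> (1 / \<kappa>) * curve_speed M \<gamma> s"
    proof (cases "s \<in> F")
      case True
      have "0 \<le> curve_speed M \<gamma> s" by (rule nonneg) (use s t in auto)
      then show ?thesis using True \<kappa>(1) by (simp add: v_def)
    next
      case False
      then have "curve_speed M \<gamma> s = sqrt (metric M c (\<gamma> s) (v s) (v s))"
        using smooth[of s] s by (simp add: v_def)
      then show ?thesis using \<kappa>(2)[OF s, of "v s"] \<kappa>(1) by (simp add: field_simps)
    qed
  qed
  also have "\<dots> = (1 / \<kappa>) * integral {a..t} (curve_speed M \<gamma>)" by (rule integral_mult_right)
  finally have "norm (?f t - ?f a) \<le> (1 / \<kappa>) * integral {a..t} (curve_speed M \<gamma>)"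
    using integral_unique[OF hi] by simp
  then have "\<kappa> * dist (?f a) (?f t) \<le> integral {a..t} (curve_speed M \<gamma>)"
    using \<kappa>(1) by (simp add: dist_norm norm_minus_commute field_simps)
  also have "\<dots> \<le> integral {a..b} (curve_speed M \<gamma>)"
    by (rule integral_subset_le[OF _ int_t int]) (use t nonneg in auto)
  finally show ?thesis by (simp add: curve_length_def)
qed

lemma compact_closedin_points:
  assumes "compact K" "K \<subseteq> points M"
  shows "closedin (top_of_set (points M)) K"
proof (rule compactin_imp_closedin)
  show "Hausdorff_space (top_of_set (points M))"
    using manifold by (simp add: connected_riemannian_manifold_def)
  show "compactin (top_of_set (points M)) K"
    using assms by (simp add: compactin_subtopology)
qed

text \<open>A curve leaving a small closed chart ball must cross the ball's boundary, hence has length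
  bounded below. That the ball is closed in the manifold is where the Hausdorff property enters.\<close>

lemma riem_dist_pos:
  assumes x: "x \<in> points M" and y: "y \<in> points M" and "x \<noteq> y"
  shows "0 < riem_dist M x y"
proof -
  obtain c where c: "c \<in> atlas M" "x \<in> fst c" using chart_at[OF x] by blast
  let ?U = "fst c" and ?\<phi> = "snd c"
  obtain R where R: "R > 0" "cball (?\<phi> x) R \<subseteq> ?\<phi> ` ?U"
    using open_chart_image[OF c(1)] c(2) by (meson imageI open_contains_cball)
  \<comment> \<open>If \<open>y\<close> lies in the chart, half of its coordinate distance keeps it
    outside the closed ball; otherwise it is outside the chart domain anyway.\<close>
  define r where "r = (if y \<in> ?U then min R (dist (?\<phi> x) (?\<phi> y) / 2) else R)"
  have "?\<phi> x \<noteq> ?\<phi> y" if "y \<in> ?U"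
    using inj_onD[OF inj_on_chart[OF c(1)], of x y] c(2) that \<open>x \<noteq> y\<close> by blast
  then have r: "0 < r" "r \<le> R" "y \<in> ?U \<Longrightarrow> r < dist (?\<phi> x) (?\<phi> y)"
    using R(1) by (auto simp: r_def min_less_iff_disj)
  let ?C = "cball (?\<phi> x) r"
  have C: "compact ?C" "?C \<subseteq> ?\<phi> ` ?U" using R(2) r(2) by (auto simp: subset_cball)
  obtain \<kappa> where \<kappa>: "0 < \<kappa>"
      "\<And>p v. p \<in> ?U \<Longrightarrow> ?\<phi> p \<in> ?C \<Longrightarrow> \<kappa> * norm v \<le> sqrt (metric M c p v v)"
    by (rule metric_lower_bound[OF c(1) C]) blast
  define K where "K = ?U \<inter> ?\<phi> -` ?C"
  define Q where "Q = ?U \<inter> ?\<phi> -` ball (?\<phi> x) r"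
  \<comment> \<open>Exhibits \<open>K\<close> as a continuous image of a compact ball; as a preimage
    under the chart it would only be seen to be closed in the chart domain.\<close>
  have "K = chart_inv c ` ?C"
  proof
    show "K \<subseteq> chart_inv c ` ?C"
    proof
      fix p assume "p \<in> K"
      then show "p \<in> chart_inv c ` ?C" using c(1) by (intro image_eqI[of _ _ "?\<phi> p"]) (auto simp: K_def)
    qed
    show "chart_inv c ` ?C \<subseteq> K"
    proof (rule image_subsetI)
      fix z assume "z \<in> ?C"
      moreover from this have "z \<in> ?\<phi> ` ?U" using C(2) by blast
      ultimately show "chart_inv c z \<in> K" by (simp add: K_def inv_into_into f_inv_into_f)
    qed
  qed
  then have "compact K"
    using compact_continuous_image[OF continuous_on_subset[OF continuous_on_chart_inv[OF c(1)] C(2)] C(1)]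
    by simp
  moreover have "K \<subseteq> points M" using chart_subset_points[OF c(1)] by (auto simp: K_def)
  ultimately have closed_K: "closedin (top_of_set (points M)) K" by (rule compact_closedin_points)
  have open_Q: "openin (top_of_set (points M)) Q"
    unfolding Q_def
    by (rule openin_trans[OF continuous_openin_preimage_gen[OF continuous_on_chart[OF c(1)] open_ball]
          openin_chart[OF c(1)]])
  have QK: "Q \<subseteq> K" by (auto simp: Q_def K_def)
  have "\<kappa> * r \<le> riem_dist M x y"
  proof (rule riem_dist_greatest[OF x y])
    fix \<gamma> a b assume \<gamma>: "piecewise_smooth_curve M \<gamma> a b" "\<gamma> a = x" "\<gamma> b = y"
    have ab: "a < b" and cont: "continuous_on {a..b} \<gamma>" and img: "\<gamma> ` {a..b} \<subseteq> points M"
      using \<gamma>(1) by (auto simp: piecewise_smooth_curve_def)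
    \<comment> \<open>The parameters at which the curve is outside the open chart ball;
      \<open>E\<close> is closed and contains \<open>b\<close>, so its infimum is the first exit
      time.\<close>
    define E where "E = {a..b} \<inter> \<gamma> -` (points M - Q)"
    have "closedin (top_of_set {a..b}) E"
      unfolding E_def
    proof (rule continuous_closedin_preimage_gen[OF cont])
      show "\<gamma> \<in> {a..b} \<rightarrow> points M" using img by blast
      show "closedin (top_of_set (points M)) (points M - Q)"
        using closedin_diff[OF closedin_topspace open_Q] by simp
    qed
    then have "closed E" using closedin_closed_trans by blast
    moreover have "b \<in> E" using ab \<gamma>(3) y r(3) by (auto simp: E_def Q_def)
    moreover have bdd: "bdd_below E" by (rule bdd_belowI[of _ a]) (auto simp: E_def)
    ultimately have "Inf E \<in> E" using closed_contains_Inf[of E] by blast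
    then obtain t where t: "t = Inf E" "t \<in> {a..b}" "\<gamma> t \<notin> Q" by (auto simp: E_def)
    have before: "\<gamma> s \<in> Q" if "s \<in> {a..<t}" for s
    proof (rule ccontr)
      assume "\<gamma> s \<notin> Q"
      then have "s \<in> E" using that t(2) img by (auto simp: E_def)
      then show False using cInf_lower[OF _ bdd] that t(1) by fastforce
    qed
    have "x \<in> Q" using c(2) r(1) by (simp add: Q_def)
    then have "a < t" using t(2,3) \<gamma>(2) by (cases "a = t") auto
    \<comment> \<open>The exit point is not in \<open>Q\<close>, but as a limit of points of the
      closed set \<open>K\<close> it still lies in the chart. Hence its coordinates are at distance
      at least \<open>r\<close> from those of \<open>x\<close>.\<close>
    have "closedin (top_of_set {a..b}) ({a..b} \<inter> \<gamma> -` K)"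
      using img by (intro continuous_closedin_preimage_gen[OF cont _ closed_K]) blast
    then have "closed ({a..b} \<inter> \<gamma> -` K)" using closedin_closed_trans by blast
    moreover have "{a..<t} \<subseteq> {a..b} \<inter> \<gamma> -` K" 
    proof
      fix s assume s: "s \<in> {a..<t}"
      then show "s \<in> {a..b} \<inter> \<gamma> -` K" using before[OF s] QK t(2) by auto
    qed
    ultimately have "closure {a..<t} \<subseteq> {a..b} \<inter> \<gamma> -` K" by (rule closure_minimal[rotated])
    then have in_K: "{a..t} \<subseteq> \<gamma> -` K" using \<open>a < t\<close> by auto
    have "\<kappa> * dist (?\<phi> (\<gamma> a)) (?\<phi> (\<gamma> t)) \<le> curve_length M \<gamma> a b"
    proof (rule curve_length_lower_bound[OF \<gamma>(1) t(2) c(1) _ \<kappa>(1)])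
      show "\<gamma> ` {a..t} \<subseteq> ?U" using in_K by (auto simp: K_def)
      show "\<kappa> * norm v \<le> sqrt (metric M c (\<gamma> s) v v)" if "s \<in> {a..t}" for s v
        using in_K that by (intro \<kappa>(2)) (auto simp: K_def)
    qed
    moreover have "\<gamma> t \<in> ?U" using in_K t(2) by (auto simp: K_def)
    then have "r \<le> dist (?\<phi> x) (?\<phi> (\<gamma> t))" using t(3) by (auto simp: Q_def)
    then have "\<kappa> * r \<le> \<kappa> * dist (?\<phi> x) (?\<phi> (\<gamma> t))" using \<kappa>(1) by (intro mult_left_mono) auto
    ultimately show "\<kappa> * r \<le> curve_length M \<gamma> a b" using \<gamma>(2) by simp
  qed
  moreover have "0 < \<kappa> * r" using \<kappa>(1) r(1) by simp
  ultimately show ?thesis by linarith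
qed

text \<open>A nonempty open subset of a Euclidean space of positive dimension is infinite, and a
  chart domain is in bijection with one.\<close>

lemma two_points: "\<exists>a\<in>points M. \<exists>b\<in>points M. a \<noteq> b"
proof -
  obtain p where "p \<in> points M" using manifold by (auto simp: connected_riemannian_manifold_def)
  then obtain c where c: "c \<in> atlas M" "p \<in> fst c" by (rule chart_at)
  have "infinite (snd c ` fst c)"
    using open_chart_image[OF c(1)] c(2) finite_imp_not_open by blast
  then have "infinite (fst c)" by blast
  then obtain q where "q \<in> fst c" "q \<noteq> p" by (metis finite.emptyI finite.insertI finite_subset singleton_iff subsetI)
  then show ?thesis using c chart_subset_points by blast
qed

end

section \<open>Lifting curves along a covering\<close>

text \<open>Short intervals lift through evenly covered sets, and bisection passes to the whole
  interval. The prescribed parameter \<open>t0\<close> may be interior, because smooth segments are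
  lifted together with an extension beyond their starting point.\<close>

lemma covering_space_lift_interval:
  fixes g :: "real \<Rightarrow> 'b::topological_space" and p :: "'a::topological_space \<Rightarrow> 'b"
  assumes cov: "covering_space C p S" and cont: "continuous_on {a..b} g" and img: "g ` {a..b} \<subseteq> S"
    and t0: "t0 \<in> {a..b}" and w: "w \<in> C" "p w = g t0"
  obtains h where "continuous_on {a..b} h" "h ` {a..b} \<subseteq> C" "\<And>t. t \<in> {a..b} \<Longrightarrow> p (h t) = g t" "h t0 = w"
proof -
  define lift where "lift u v h \<longleftrightarrow> continuous_on {u..v} h \<and> h ` {u..v} \<subseteq> C \<and> (\<forall>t\<in>{u..v}. p (h t) = g t)"
    for u v h
  \<comment> \<open>Every point over every parameter of the interval is allowed as prescribed value,
    so that adjacent intervals can be matched at their common end.\<close>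
  define P where "P u v \<longleftrightarrow> (a \<le> u \<and> v \<le> b \<longrightarrow>
    (\<forall>t\<in>{u..v}. \<forall>w\<in>C. p w = g t \<longrightarrow> (\<exists>h. lift u v h \<and> h t = w)))" for u v
  have glue: "lift u x (\<lambda>t. if t \<le> v then h t else k t)"
    if "lift u v h" "lift v x k" "h v = k v" "u \<le> v" "v \<le> x" for u v x h k
  proof -
    let ?f = "\<lambda>t. if t \<le> v then h t else k t"
    have "continuous_on {u..v} ?f"
      by (rule continuous_on_eq[of _ h]) (use that(1) in \<open>auto simp: lift_def\<close>)
    moreover have "continuous_on {v..x} ?f"
      by (rule continuous_on_eq[of _ k]) (use that(2,3) in \<open>auto simp: lift_def\<close>)
    ultimately have "continuous_on {u..x} ?f" using that(4,5) by (rule continuous_on_Icc_combine)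
    then show ?thesis using that by (auto simp: lift_def)
  qed
  have "a \<le> b" using t0 by simp
  then have "P a b"
  proof (induction rule: Bolzano)
    case (trans u v x)
    show ?case
      unfolding P_def
    proof (intro impI ballI)
      fix t w assume uv: "a \<le> u \<and> x \<le> b" and t: "t \<in> {u..x}" and w: "w \<in> C" "p w = g t"
      have P1: "\<exists>h. lift u v h \<and> h s = z" if "s \<in> {u..v}" "z \<in> C" "p z = g s" for s z
        using trans(1,3,4) uv that by (auto simp: P_def)
      have P2: "\<exists>h. lift v x h \<and> h s = z" if "s \<in> {v..x}" "z \<in> C" "p z = g s" for s z
        using trans(2,3,4) uv that by (auto simp: P_def)
      \<comment> \<open>The part containing \<open>t\<close> is lifted first, through
        \<open>w\<close>; its value at \<open>v\<close> then prescribes the lift over the other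
        part.\<close>
      show "\<exists>h. lift u x h \<and> h t = w"
      proof (cases "t \<le> v")
        case True
        then obtain h where h: "lift u v h" "h t = w" using P1[of t w] t w by auto
        then have "h v \<in> C" "p (h v) = g v" using trans(3) by (auto simp: lift_def)
        then obtain k where k: "lift v x k" "k v = h v" using P2[of v "h v"] trans(4) by auto
        show ?thesis
          using glue[OF h(1) k(1) k(2)[symmetric] trans(3,4)] h(2) True by fastforce
      next
        case False
        then obtain k where k: "lift v x k" "k t = w" using P2[of t w] t w by auto
        then have "k v \<in> C" "p (k v) = g v" using trans(4) by (auto simp: lift_def)
        then obtain h where h: "lift u v h" "h v = k v" using P1[of v "k v"] trans(3) by auto
        show ?thesis
          using glue[OF h(1) k(1) h(2) trans(3,4)] k(2) False by fastforce
      qed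
    qed
  next
    case (local x)
    then have "g x \<in> S" using img by auto
    \<comment> \<open>Near \<open>x\<close> the curve stays in an evenly covered set
      \<open>T\<close>, and the inverse of the covering on the sheet through \<open>w\<close> gives
      the lift.\<close>
    then obtain T v where T: "g x \<in> T" "openin (top_of_set S) T" and v: "\<Union>v = C \<inter> p -` T"
        "\<And>u. u \<in> v \<Longrightarrow> \<exists>q. homeomorphism u T p q"
      using cov unfolding covering_space_def by metis
    have "openin (top_of_set {a..b}) ({a..b} \<inter> g -` T)"
      using continuous_openin_preimage[OF cont _ T(2)] img by blast
    moreover have "x \<in> {a..b} \<inter> g -` T" using local T(1) by simp
    ultimately obtain d where d: "d > 0" "ball x d \<inter> {a..b} \<subseteq> {a..b} \<inter> g -` T"
      unfolding openin_contains_ball by blast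
    have "P u z" if uz: "u \<le> x \<and> x \<le> z \<and> z - u < d" for u z
      unfolding P_def
    proof (intro impI ballI)
      fix t w assume ab: "a \<le> u \<and> z \<le> b" and t: "t \<in> {u..z}" and w: "w \<in> C" "p w = g t"
      have "{u..z} \<subseteq> ball x d \<inter> {a..b}" using uz ab by (auto simp: dist_real_def)
      then have sub: "{u..z} \<subseteq> {a..b}" "g ` {u..z} \<subseteq> T" using d(2) by auto
      then have "w \<in> \<Union>v" using w t v(1) by auto
      then obtain U q where U: "U \<in> v" "w \<in> U" "homeomorphism U T p q" using v(2) by blast
      have "continuous_on {u..z} (q \<circ> g)"
        using continuous_on_subset[OF cont sub(1)] continuous_on_subset[OF homeomorphism_cont2[OF U(3)] sub(2)]
        by (rule continuous_on_compose)
      moreover have "q (g s) \<in> U" "p (q (g s)) = g s" if "s \<in> {u..z}" for s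
      proof -
        have "g s \<in> T" using sub(2) that by blast
        then show "q (g s) \<in> U" "p (q (g s)) = g s"
          using homeomorphism_image2[OF U(3)] homeomorphism_apply2[OF U(3)] by blast+
      qed
      moreover have "U \<subseteq> C" using U(1) v(1) by blast
      ultimately have "lift u z (q \<circ> g)" unfolding lift_def by auto
      moreover have "(q \<circ> g) t = w" using U(2,3) w(2) by (metis comp_apply homeomorphism_apply1)
      ultimately show "\<exists>h. lift u z h \<and> h t = w" by blast
    qed
    then show ?case using d(1) by blast
  qed
  then show thesis using t0 w that unfolding P_def lift_def by blast
qed


section \<open>Locally isometric coverings\<close>

context riem_manifold
begin

text \<open>A smooth map is described in charts, and the chart of the source has to follow the
  curve, so the argument is local in the parameter.\<close>

lemma smooth_curve_smooth_map:
  assumes f: "smooth_map_on M N A f" and \<gamma>: "smooth_curve M J \<gamma>" "open J" "\<gamma> ` J \<subseteq> A"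
    and N: "riem_manifold N"
  shows "smooth_curve N J (f \<circ> \<gamma>)"
proof -
  interpret N: riem_manifold N by (rule N)
  have f': "continuous_on A f" "f ` A \<subseteq> points N"
    and smooth_f: "\<And>c d. c \<in> atlas M \<Longrightarrow> d \<in> atlas N \<Longrightarrow>
      smooth_on (snd c ` (A \<inter> fst c \<inter> f -` fst d)) (chart_rep c d f)"
    using f unfolding smooth_map_on_def by blast+
  have "continuous_on J \<gamma>" using \<gamma>(1) by (simp add: smooth_curve_def)
  then have cont: "continuous_on J (f \<circ> \<gamma>)"
    using continuous_on_subset[OF f'(1) \<gamma>(3)] by (rule continuous_on_compose)
  have img: "(f \<circ> \<gamma>) ` J \<subseteq> points N" using f'(2) \<gamma>(3) by auto
  have "smooth_on (J \<inter> (f \<circ> \<gamma>) -` fst d) (snd d \<circ> (f \<circ> \<gamma>))" if d: "d \<in> atlas N" for d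
  proof (rule smooth_on_local)
    fix t assume t: "t \<in> J \<inter> (f \<circ> \<gamma>) -` fst d"
    then have "\<gamma> t \<in> points M" using \<gamma>(1) by (auto simp: smooth_curve_def)
    then obtain c where c: "c \<in> atlas M" "\<gamma> t \<in> fst c" by (rule chart_at)
    let ?T = "(J \<inter> \<gamma> -` fst c) \<inter> (J \<inter> (f \<circ> \<gamma>) -` fst d)"
    have T: "open ?T"
      using open_smooth_curve_vimage[OF \<gamma>(1,2) openin_chart[OF c(1)]]
        open_vimage_openin[OF \<gamma>(2) cont img N.openin_chart[OF d]] by (rule open_Int)
    have "smooth_on ?T (chart_rep c d f \<circ> (snd c \<circ> \<gamma>))"
    proof (rule smooth_on_compose[OF T _ smooth_f[OF c(1) d]])
      show "(snd c \<circ> \<gamma>) ` ?T \<subseteq> snd c ` (A \<inter> fst c \<inter> f -` fst d)" using \<gamma>(3) by auto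
      show "smooth_on ?T (snd c \<circ> \<gamma>)"
        by (rule smooth_on_subset[OF smooth_curve_smooth_on[OF \<gamma>(1) c(1)]]) blast
    qed
    then have "smooth_on ?T (snd d \<circ> (f \<circ> \<gamma>))"
      by (rule smooth_on_cong[OF T, rotated]) (use c(1) in \<open>simp add: chart_rep_def\<close>)
    then show "\<exists>T. open T \<and> t \<in> T \<and> smooth_on T (snd d \<circ> (f \<circ> \<gamma>))"
      using T t c(2) by (intro exI[of _ ?T]) auto
  qed
  then show ?thesis using cont img by (simp add: smooth_curve_def)
qed

text \<open>By the chain rule the differential of \<open>f\<close> carries one velocity to the
  other, and it preserves inner products.\<close>

lemma curve_speed_isometry:
  assumes f: "isometry_between M N A B f" and \<gamma>: "smooth_curve M J \<gamma>" "open J"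
    and t: "t \<in> J" "\<gamma> t \<in> A" and N: "riem_manifold N"
  shows "curve_speed N (f \<circ> \<gamma>) t = curve_speed M \<gamma> t"
proof -
  interpret N: riem_manifold N by (rule N)
  have smooth: "smooth_map_on M N A f"
    and iso: "\<And>c d p u v. c \<in> atlas M \<Longrightarrow> d \<in> atlas N \<Longrightarrow> p \<in> A \<inter> fst c \<inter> f -` fst d \<Longrightarrow>
      metric M c p u v = metric N d (f p)
        (frechet_derivative (chart_rep c d f) (at (snd c p)) u)
        (frechet_derivative (chart_rep c d f) (at (snd c p)) v)"
    using f unfolding isometry_between_def Let_def by blast+
  have p: "\<gamma> t \<in> points M" using \<gamma>(1) t(1) by (auto simp: smooth_curve_def)
  have q: "f (\<gamma> t) \<in> points N" using smooth t(2) by (auto simp: smooth_map_on_def)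
  let ?c = "chart_for (\<gamma> t)" and ?d = "N.chart_for (f (\<gamma> t))"
  note c = chart_for[OF p] and d = N.chart_for[OF q]
  have "smooth_on (snd ?c ` (A \<inter> fst ?c \<inter> f -` fst ?d)) (chart_rep ?c ?d f)"
    using smooth c(1) d(1) unfolding smooth_map_on_def by blast
  then have "chart_rep ?c ?d f differentiable (at (snd ?c (\<gamma> t)))"
    by (rule smooth_on_imp_differentiable) (use t(2) c(2) d(2) in blast)
  note velocity_chart_rep[OF \<gamma> t(1) c this]
  moreover have "(f \<circ> \<gamma>) t = f (\<gamma> t)" by simp
  moreover have "\<gamma> t \<in> A \<inter> fst ?c \<inter> f -` fst ?d" using t(2) c(2) d(2) by blast
  note iso[OF c(1) d(1) this]
  ultimately show ?thesis by (simp only: curve_speed_chart_for N.curve_speed_chart_for)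
qed

end

locale isometric_covering = W: riem_manifold W + M: riem_manifold M
  for W :: "('a::topological_space, 'e::euclidean_space) riem"
    and M :: "('b::topological_space, 'f::euclidean_space) riem" +
  fixes \<pi> :: "'a \<Rightarrow> 'b"
  assumes covering: "locally_isometric_covering W M \<pi>"
begin

lemma local_isometry_at:
  assumes "p \<in> points W"
  obtains A B where "p \<in> A" "isometry_between W M A B \<pi>" "openin (top_of_set (points W)) A"
  using assms covering unfolding locally_isometric_covering_def local_isometry_def isometry_between_def
  by metis

lemma covering_map: "covering_space (points W) \<pi> (points M)"
  using covering by (simp add: locally_isometric_covering_def)

lemma smooth_curve_projection:
  assumes \<gamma>: "smooth_curve W J \<gamma>" and J: "open J"
  shows "smooth_curve M J (\<pi> \<circ> \<gamma>)"
proof (rule M.smooth_curve_local)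
  fix t assume t: "t \<in> J"
  then have "\<gamma> t \<in> points W" using \<gamma> by (auto simp: smooth_curve_def)
  then obtain A B where A: "\<gamma> t \<in> A" "isometry_between W M A B \<pi>" "openin (top_of_set (points W)) A"
    by (rule local_isometry_at)
  let ?I = "J \<inter> \<gamma> -` A"
  have I: "open ?I" by (rule W.open_smooth_curve_vimage[OF \<gamma> J A(3)])
  have "smooth_map_on W M A \<pi>" using A(2) unfolding isometry_between_def by blast
  then have "smooth_curve M ?I (\<pi> \<circ> \<gamma>)"
    by (rule W.smooth_curve_smooth_map[OF _ W.smooth_curve_subset[OF \<gamma>] I])
      (auto intro: M.riem_manifold_axioms)
  then show "\<exists>I. open I \<and> t \<in> I \<and> smooth_curve M I (\<pi> \<circ> \<gamma>)" using I t A(1) by blast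
qed

text \<open>Near each parameter the lift stays in one isometric neighbourhood by continuity, and
  there it is \<open>\<eta>\<close> followed by the smooth local inverse of the covering.\<close>

lemma smooth_curve_lift:
  assumes \<eta>: "smooth_curve M J \<eta>" and J: "open J"
    and h: "continuous_on J h" "h ` J \<subseteq> points W" "\<And>t. t \<in> J \<Longrightarrow> \<pi> (h t) = \<eta> t"
  shows "smooth_curve W J h"
proof (rule W.smooth_curve_local)
  fix t assume t: "t \<in> J"
  then have "h t \<in> points W" using h(2) by blast
  then obtain A B where A: "h t \<in> A" "isometry_between W M A B \<pi>" "openin (top_of_set (points W)) A"
    by (rule local_isometry_at)
  then obtain g where g: "homeomorphism A B \<pi> g" "smooth_map_on M W B g"
    unfolding isometry_between_def by blast
  let ?I = "J \<inter> h -` A"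
  have I: "open ?I" by (rule open_vimage_openin[OF J h(1,2) A(3)])
  have "\<eta> ` ?I \<subseteq> B"
  proof (rule image_subsetI)
    fix s assume "s \<in> ?I"
    then show "\<eta> s \<in> B" using h(3)[of s] homeomorphism_image1[OF g(1)] by force
  qed
  from M.smooth_curve_smooth_map[OF g(2) M.smooth_curve_subset[OF \<eta>] I this W.riem_manifold_axioms]
  have "smooth_curve W ?I (g \<circ> \<eta>)" by blast
  then have "smooth_curve W ?I h"
  proof (rule W.smooth_curve_cong[OF _ I])
    fix s assume "s \<in> ?I"
    then show "(g \<circ> \<eta>) s = h s" using h(3)[of s] homeomorphism_apply1[OF g(1), of "h s"] by simp
  qed
  then show "\<exists>I. open I \<and> t \<in> I \<and> smooth_curve W I h" using I t A(1) by blast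
qed

section \<open>Projection and lifting of piecewise smooth curves\<close>

lemma piecewise_smooth_curve_projection:
  assumes "piecewise_smooth_curve W \<gamma> a b"
  shows "piecewise_smooth_curve M (\<pi> \<circ> \<gamma>) a b"
  using assms
proof (induction rule: W.piecewise_smooth_curve_induct)
  case (segment s t)
  then obtain \<delta> \<eta> where \<eta>: "\<delta> > 0" "smooth_curve W {s - \<delta> <..< t + \<delta>} \<eta>"
      "\<And>u. u \<in> {s..t} \<Longrightarrow> \<eta> u = \<gamma> u"
    by (auto simp: smooth_curve_segment_def)
  have "smooth_curve M {s - \<delta> <..< t + \<delta>} (\<pi> \<circ> \<eta>)"
    by (rule smooth_curve_projection[OF \<eta>(2) open_greaterThanLessThan])
  then have "smooth_curve_segment M (\<pi> \<circ> \<gamma>) s t"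
    unfolding smooth_curve_segment_def using \<eta>(1,3)
    by (intro exI[of _ \<delta>] conjI exI[of _ "\<pi> \<circ> \<eta>"]) simp_all
  with segment(1) show ?case by (rule M.piecewise_smooth_curve_segment)
next
  case (join s t u)
  show ?case using join(3,4) by (rule M.piecewise_smooth_curve_join)
qed

lemma curve_length_projection:
  assumes "piecewise_smooth_curve W \<gamma> a b"
  shows "curve_length M (\<pi> \<circ> \<gamma>) a b = curve_length W \<gamma> a b"
proof -
  obtain F where F: "finite F" "\<And>t. t \<in> {a..b} - F \<Longrightarrow> \<exists>I. open I \<and> t \<in> I \<and> smooth_curve W I \<gamma>"
    by (rule W.piecewise_smooth_curve_smooth_off_finite[OF assms]) blast
  have "curve_speed W \<gamma> t = curve_speed M (\<pi> \<circ> \<gamma>) t" if t: "t \<in> {a..b} - F" for t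
  proof -
    obtain I where I: "open I" "t \<in> I" "smooth_curve W I \<gamma>" using F(2)[OF t] by blast
    have "\<gamma> t \<in> points W" using W.piecewise_smooth_curve_in_points[OF assms] t by blast
    then obtain A B where A: "\<gamma> t \<in> A" "isometry_between W M A B \<pi>" by (rule local_isometry_at)
    show ?thesis
      using W.curve_speed_isometry[OF A(2) I(3,1,2) A(1) M.riem_manifold_axioms] by simp
  qed
  then show ?thesis
    unfolding curve_length_def by (intro integral_spike[OF negligible_finite[OF F(1)]]) simp
qed

text \<open>On a smooth piece the extension \<open>\<eta>\<close> is lifted instead of
  \<open>\<gamma>\<close>, so that the lift again has a smooth extension. The next piece is lifted
  from the end of the previous one.\<close>

lemma piecewise_smooth_curve_lift:
  assumes "piecewise_smooth_curve M \<gamma> a b" "w \<in> points W" "\<pi> w = \<gamma> a"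
  obtains h where "piecewise_smooth_curve W h a b" "h a = w" "\<And>t. t \<in> {a..b} \<Longrightarrow> \<pi> (h t) = \<gamma> t"
proof -
  have "\<forall>w\<in>points W. \<pi> w = \<gamma> a \<longrightarrow>
    (\<exists>h. piecewise_smooth_curve W h a b \<and> h a = w \<and> (\<forall>t\<in>{a..b}. \<pi> (h t) = \<gamma> t))"
    using assms(1)
  proof (induction rule: M.piecewise_smooth_curve_induct)
    case (segment s t)
    then obtain \<delta> \<eta> where \<eta>: "\<delta> > 0" "smooth_curve M {s - \<delta> <..< t + \<delta>} \<eta>"
        "\<And>u. u \<in> {s..t} \<Longrightarrow> \<eta> u = \<gamma> u"
      by (auto simp: smooth_curve_segment_def)
    \<comment> \<open>Half of the margin keeps the closed interval \<open>J\<close>, over which the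
      lift exists, inside the domain of \<open>\<eta>\<close> and leaves the open interval
      \<open>I\<close> around \<open>[s, t]\<close> for the extension.\<close>
    define J where "J = {s - \<delta> / 2 .. t + \<delta> / 2}"
    define I where "I = {s - \<delta> / 2 <..< t + \<delta> / 2}"
    have J: "J \<subseteq> {s - \<delta> <..< t + \<delta>}" and I: "open I" "I \<subseteq> J" and st: "{s..t} \<subseteq> J" "s \<in> J"
      using \<eta>(1) segment(1) by (auto simp: J_def I_def)
    have \<eta>': "smooth_curve M J \<eta>" by (rule M.smooth_curve_subset[OF \<eta>(2) J])
    show ?case
    proof (intro ballI impI)
      fix w assume w: "w \<in> points W" "\<pi> w = \<gamma> s"
      then have "\<pi> w = \<eta> s" using \<eta>(3)[of s] segment(1) by simp
      moreover have "continuous_on J \<eta>" "\<eta> ` J \<subseteq> points M" using \<eta>' by (auto simp: smooth_curve_def)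
      ultimately obtain h where h: "continuous_on J h" "h ` J \<subseteq> points W"
          "\<And>u. u \<in> J \<Longrightarrow> \<pi> (h u) = \<eta> u" "h s = w"
        using covering_space_lift_interval[OF covering_map, of _ _ \<eta> s w] st(2) w(1)
        unfolding J_def by blast
      have "smooth_curve W I h"
      proof (rule smooth_curve_lift[OF M.smooth_curve_subset[OF \<eta>' I(2)] I(1)])
        show "continuous_on I h" by (rule continuous_on_subset[OF h(1) I(2)])
        show "h ` I \<subseteq> points W" "\<And>u. u \<in> I \<Longrightarrow> \<pi> (h u) = \<eta> u" using h(2,3) I(2) by auto
      qed
      then have "smooth_curve_segment W h s t"
        unfolding smooth_curve_segment_def I_def using \<eta>(1)
        by (intro exI[of _ "\<delta> / 2"] conjI exI[of _ h]) simp_all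
      with segment(1) have "piecewise_smooth_curve W h s t" by (rule W.piecewise_smooth_curve_segment)
      moreover have "\<forall>u\<in>{s..t}. \<pi> (h u) = \<gamma> u" using h(3) \<eta>(3) st(1) by auto
      ultimately show "\<exists>h. piecewise_smooth_curve W h s t \<and> h s = w \<and> (\<forall>u\<in>{s..t}. \<pi> (h u) = \<gamma> u)"
        using h(4) by blast
    qed
  next
    case (join s t u)
    show ?case
    proof (intro ballI impI)
      fix w assume "w \<in> points W" "\<pi> w = \<gamma> s"
      then obtain h where h: "piecewise_smooth_curve W h s t" "h s = w"
          "\<And>v. v \<in> {s..t} \<Longrightarrow> \<pi> (h v) = \<gamma> v"
        using join(3) by blast
      have "h t \<in> points W" "\<pi> (h t) = \<gamma> t"
        using W.piecewise_smooth_curve_in_points[OF h(1), of t] h(3)[of t] join(1) by auto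
      then obtain k where k: "piecewise_smooth_curve W k t u" "k t = h t"
          "\<And>v. v \<in> {t..u} \<Longrightarrow> \<pi> (k v) = \<gamma> v"
        using join(4) by blast
      have "piecewise_smooth_curve W (\<lambda>v. if v \<le> t then h v else k v) s u"
        by (rule W.piecewise_smooth_curve_glue[OF h(1) k(1) k(2)[symmetric]])
      then show "\<exists>h. piecewise_smooth_curve W h s u \<and> h s = w \<and> (\<forall>v\<in>{s..u}. \<pi> (h v) = \<gamma> v)"
        using h(2,3) k(3) join(1)
        by (intro exI[of _ "\<lambda>v. if v \<le> t then h v else k v"]) auto
    qed
  qed
  then show thesis using assms(2,3) that by blast
qed

section \<open>Distances in the base and in the total space\<close>

lemma projection_in_points: "p \<in> points W \<Longrightarrow> \<pi> p \<in> points M"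
  using covering_space_imp_surjective[OF covering_map] by blast

lemma riem_dist_projection_le:
  assumes "x \<in> points W" "y \<in> points W"
  shows "riem_dist M (\<pi> x) (\<pi> y) \<le> riem_dist W x y"
proof (rule W.riem_dist_greatest[OF assms])
  fix \<gamma> a b assume \<gamma>: "piecewise_smooth_curve W \<gamma> a b" "\<gamma> a = x" "\<gamma> b = y"
  then show "riem_dist M (\<pi> x) (\<pi> y) \<le> curve_length W \<gamma> a b"
    using M.riem_dist_le[OF piecewise_smooth_curve_projection[OF \<gamma>(1)]] curve_length_projection[OF \<gamma>(1)]
    by simp
qed

text \<open>The point over \<open>y\<close> is the end of the lift, from \<open>x\<close>, of an
  almost minimizing curve. It depends on \<open>x\<close>, which is why sections are built along
  trees.\<close>

lemma riem_dist_lift: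
  assumes x: "x \<in> points W" and y: "y \<in> points M" and "0 < \<epsilon>"
  shows "\<exists>x'\<in>points W. \<pi> x' = y \<and> riem_dist W x x' \<le> riem_dist M (\<pi> x) y + \<epsilon>"
proof -
  obtain \<gamma> a b where \<gamma>: "piecewise_smooth_curve M \<gamma> a b" "\<gamma> a = \<pi> x" "\<gamma> b = y"
      "curve_length M \<gamma> a b \<le> riem_dist M (\<pi> x) y + \<epsilon>"
    using M.almost_minimizing_curve[OF projection_in_points[OF x] y \<open>0 < \<epsilon>\<close>] by blast
  obtain h where h: "piecewise_smooth_curve W h a b" "h a = x" "\<And>t. t \<in> {a..b} \<Longrightarrow> \<pi> (h t) = \<gamma> t"
    using piecewise_smooth_curve_lift[OF \<gamma>(1) x] \<gamma>(2) by metis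
  have "a < b" using \<gamma>(1) by (simp add: piecewise_smooth_curve_def)
  have lift_eq: "(\<pi> \<circ> h) t = \<gamma> t" if "t \<in> {a<..<b}" for t using h(3) that by simp
  have "riem_dist W x (h b) \<le> curve_length W h a b" using W.riem_dist_le[OF h(1)] h(2) by simp
  also have "\<dots> = curve_length M (\<pi> \<circ> h) a b" by (rule curve_length_projection[OF h(1), symmetric])
  also have "\<dots> = curve_length M \<gamma> a b"
    unfolding curve_length_def
  \<comment> \<open>\<open>\<pi> \<circ> h\<close> and \<open>\<gamma>\<close> agree only on the
    closed interval, so their two-sided derivatives may differ at its end points.\<close>
  proof (rule integral_spike[of "{a, b}"])
    show "negligible {a, b}" by simp
    show "curve_speed M \<gamma> t = curve_speed M (\<pi> \<circ> h) t" if "t \<in> {a..b} - {a, b}" for t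
      by (rule M.curve_speed_cong[of "{a<..<b}"]) (use that lift_eq in auto)
  qed
  finally have "riem_dist W x (h b) \<le> riem_dist M (\<pi> x) y + \<epsilon>" using \<gamma>(4) by linarith
  moreover have "h b \<in> points W" "\<pi> (h b) = y"
    using W.piecewise_smooth_curve_in_points[OF h(1), of b] h(3)[of b] \<gamma>(3) \<open>a < b\<close> by auto
  ultimately show ?thesis by blast
qed

lemma steiner_ratio_le:
  "steiner_ratio (points W) (riem_dist W) \<le> steiner_ratio (points M) (riem_dist M)"
proof -
  have surj: "\<pi> ` points W = points M" by (rule covering_space_imp_surjective[OF covering_map])
  have "steiner_ratio (points W) (riem_dist W) \<le> steiner_ratio (\<pi> ` points W) (riem_dist M)"
    by (rule steiner_ratio_le_of_lifting[OF W.riem_dist_sym M.riem_dist_sym], unfold surj)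
      (fact M.riem_dist_pos M.riem_dist_nonneg riem_dist_projection_le riem_dist_lift M.two_points)+
  then show ?thesis by (simp only: surj)
qed

end

theorem theorem1p2:
  fixes W :: "('a::topological_space, 'e::euclidean_space) riem"
    and M :: "('b::topological_space, 'f::euclidean_space) riem"
    and \<pi> :: "'a \<Rightarrow> 'b"
  assumes "connected_riemannian_manifold W"
    and "connected_riemannian_manifold M"
    and "locally_isometric_covering W M \<pi>"
  shows "steiner_ratio (points M) (riem_dist M) \<ge> steiner_ratio (points W) (riem_dist W)"
proof -
  interpret isometric_covering W M \<pi> by unfold_locales (fact assms)+
  show ?thesis by (rule steiner_ratio_le)
qed

end
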